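(* Let $\delta\in(0,1)$ and let $\alpha\in(0,1)$ be irrational. Let $f\colon S^1\to S^1$ be a Denjoy map that is semi-conjugate to the rotation $R_\alpha$, with gaps $J_n$, $n\in\mathbb{Z}$, whose lengths $|J_n|=\ell_n$ form a Denjoy sequence of class $\delta$, and let $\Omega_f=S^1\setminus\bigcup_{n\in\mathbb{Z}}J_n$ be its minimal set. Let $q_n$ be the denominators of the convergents of $\alpha$, and for every $n\in\mathbb{N}$ set $$N_n:=\left[\frac{q_n+q_{n+1}}{2}\right],\qquad Q_n:=q_n+q_{n+1}.$$ Then for every $\beta>0$ the following three estimates hold. (a) $$H_\beta(\Omega_f)\geq \liminf_{n\to\infty} q_n\Big(\min\big\{|J_i| : -N_n\leq i\leq N_n\big\}\Big)^\beta .$$ (b) $$H_\beta(\Omega_f)\geq \liminf_{n\to\infty} q_n\left(\sum_{l=-\infty}^{+\infty}\min\big\{|J_i| : (2l-1)N_n\leq i\leq (2l+1)N_n\big\}\right)^\beta .$$ (c) Denoting, for every $n\in\mathbb{N}$, by $\mathcal{P}^n$ the set of all sequences of integers $(P^{(n)}_l)_{l\in\mathbb{Z}}$ satisfying $P^{(n)}_l-P^{(n)}_{l-1}=Q_n$ for all $l\in\mathbb{Z}$, $$H_\beta(\Omega_f)\geq \liminf_{n\to\infty} q_n\left(\sup\left\{\sum_{l=-\infty}^{+\infty}\min\big\{|J_i| : P^{(n)}_{l-1}\leq i< P^{(n)}_{l}\big\} : P^{(n)}\in\mathcal{P}^n\right\}\right)^\beta .$$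
   Context: $S^1$ is the circle of total length $1$ with the arc-length metric, and $R_\alpha(t)=t+\alpha \pmod 1$. $[\cdot]$ denotes the integer part and $\mathbb{N}=\{1,2,\dots\}$. Denjoy sequence of class $\delta\in(0,1)$: a sequence $(\ell_n)_{n\in\mathbb{Z}}$ of non-negative numbers (such that the logarithms below make sense) with $$\sum_{n\in\mathbb{Z}}\ell_n=1\qquad\text{and}\qquad \liminf_{n\to\pm\infty}\frac{\ln|\ell_n-\ell_{n+1}|}{\ln \ell_n}=1+\delta .$$ Denjoy map: given an irrational $\alpha\in(0,1)$ and a Denjoy sequence $(\ell_n)_{n\in\mathbb{Z}}$ of class $\delta$, start with the circle of length $1$ and the rotation $R_\alpha$, and blow up every point $n\alpha$ ($n\in\mathbb{Z}$) of the orbit of $0$ to an open arc $J_n$ of length $|J_n|=\ell_n$, rescaling the rest so that the total length remains $1$. Thus the arcs $J_n$ are pairwise disjoint and are placed on $S^1$ in the same cyclic order as the points $n\alpha$. The Denjoy map $f\colon S^1\to S^1$ is an orientation preserving diffeomorphism, of class $C^{1+\delta}$, mapping each $J_n$ diffeomorphically onto $J_{n+1}$ with derivative $1$ at the endpoints. It is semi-conjugate to $R_\alpha$, i.e. $h\circ f=R_\alpha\circ h$, by the continuous monotone surjection $h\colon S^1\to S^1$ that collapses the closure of each $J_n$ to the point $n\alpha$ and is injective elsewhere. The set $\Omega_f=S^1\setminus\bigcup_{n\in\mathbb{Z}}J_n$ is the unique minimal set of $f$. Continued fractions: $\alpha=[a_1,a_2,\ldots]$, with convergents $p_n/q_n$,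 where $q_{-1}=0$, $q_0=1$, $q_n=a_nq_{n-1}+q_{n-2}$. Hausdorff measure: $H_\beta(Y)=\lim_{r\to0}\inf\{\sum_{k=1}^\infty(\operatorname{diam}U_k)^\beta : \operatorname{diam}U_k<r \text{ for all } k,\ Y\subset\bigcup_{k=1}^\infty U_k\}$. *)

theory Defs
  imports "HOL-Analysis.Analysis"
begin

section \<open>The circle of length one\<close>

quotient_type circle = real / "\<lambda>x y::real. x - y \<in> \<int>"
proof (rule equivpI)
  show "reflp (\<lambda>x y::real. x - y \<in> \<int>)"
    by (simp add: reflp_def)
  show "symp (\<lambda>x y::real. x - y \<in> \<int>)"
    by (auto simp: symp_def) (metis Ints_minus minus_diff_eq)
  show "transp (\<lambda>x y::real. x - y \<in> \<int>)"
  proof (rule transpI)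
    fix x y z :: real
    assume "x - y \<in> \<int>" "y - z \<in> \<int>"
    then have "(x - y) + (y - z) \<in> \<int>" by (rule Ints_add)
    then show "x - z \<in> \<int>" by simp
  qed
qed

abbreviation circle_of :: "real \<Rightarrow> circle"
  where "circle_of \<equiv> abs_circle"

text \<open>The two arcs between \<open>x\<close> and \<open>y\<close> have lengths \<open>frac (x - y)\<close> and \<open>1 - frac (x - y)\<close>;
  the arc-length metric is the smaller of the two.\<close>

definition arc_dist :: "real \<Rightarrow> real \<Rightarrow> real"
  where "arc_dist x y = min (frac (x - y)) (1 - frac (x - y))"

lemma frac_diff_Ints_eq: "frac x = frac y" if "x - y \<in> \<int>" for x y :: real
proof -
  from that obtain k where "x - y = of_int k" by (auto elim: Ints_cases)
  then have "x = y + of_int k" by simp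
  then show ?thesis by (simp add: frac_def)
qed

lemma arc_dist_le: "arc_dist x y \<le> \<bar>x - y - of_int k\<bar>"
  unfolding arc_dist_def frac_def
proof -
  have a: "of_int \<lfloor>x - y\<rfloor> \<le> x - y" "x - y < of_int \<lfloor>x - y\<rfloor> + 1" by linarith+
  have "k \<le> \<lfloor>x - y\<rfloor> \<or> k \<ge> \<lfloor>x - y\<rfloor> + 1" by linarith
  then have "real_of_int k \<le> of_int \<lfloor>x - y\<rfloor> \<or> real_of_int k \<ge> of_int \<lfloor>x - y\<rfloor> + 1"
    by linarith
  with a show "min (x - y - of_int \<lfloor>x - y\<rfloor>) (1 - (x - y - of_int \<lfloor>x - y\<rfloor>)) \<le> \<bar>x - y - of_int k\<bar>"
    by linarith
qed

lemma arc_dist_attained: "\<exists>k. arc_dist x y = \<bar>x - y - of_int k\<bar>"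
proof (cases "frac (x - y) \<le> 1 - frac (x - y)")
  case True
  then have "arc_dist x y = \<bar>x - y - of_int \<lfloor>x - y\<rfloor>\<bar>"
    by (simp add: arc_dist_def frac_def)
  then show ?thesis by blast
next
  case False
  then have "arc_dist x y = \<bar>x - y - of_int (\<lfloor>x - y\<rfloor> + 1)\<bar>"
    using frac_lt_1[of "x - y"] by (simp add: arc_dist_def frac_def)
  then show ?thesis by blast
qed

instantiation circle :: metric_space
begin

lift_definition dist_circle :: "circle \<Rightarrow> circle \<Rightarrow> real" is arc_dist
proof -
  fix x x' y y' :: real
  assume "x - x' \<in> \<int>" "y - y' \<in> \<int>"
  then have "(x - x') - (y - y') \<in> \<int>" by (rule Ints_diff)
  then have "(x - y) - (x' - y') \<in> \<int>" by (simp add: algebra_simps)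
  then show "arc_dist x y = arc_dist x' y'"
    unfolding arc_dist_def by (metis frac_diff_Ints_eq)
qed

definition uniformity_circle :: "(circle \<times> circle) filter"
  where "uniformity_circle = (INF e\<in>{0<..}. principal {(x, y). dist x y < e})"

definition open_circle :: "circle set \<Rightarrow> bool"
  where "open_circle U \<longleftrightarrow> (\<forall>x\<in>U. eventually (\<lambda>(x', y). x' = x \<longrightarrow> y \<in> U) uniformity)"

instance
proof
  fix x y :: circle
  show "dist x y = 0 \<longleftrightarrow> x = y"
  proof transfer
    fix x y :: real
    have "arc_dist x y = 0 \<longleftrightarrow> frac (x - y) = 0"
      unfolding arc_dist_def using frac_lt_1[of "x - y"] frac_ge_0[of "x - y"] by linarith
    then show "arc_dist x y = 0 \<longleftrightarrow> x - y \<in> \<int>" by (simp only: frac_eq_0_iff)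
  qed
next
  fix x y z :: circle
  show "dist x y \<le> dist x z + dist y z"
  proof transfer
    fix x y z :: real
    obtain k where k: "arc_dist x z = \<bar>x - z - of_int k\<bar>" using arc_dist_attained by blast
    obtain m where m: "arc_dist y z = \<bar>y - z - of_int m\<bar>" using arc_dist_attained by blast
    show "arc_dist x y \<le> arc_dist x z + arc_dist y z"
      using arc_dist_le[of x y "k - m"] k m by simp
  qed
qed (rule uniformity_circle_def open_circle_def)+

end

lift_definition rotation :: "real \<Rightarrow> circle \<Rightarrow> circle" is "\<lambda>\<alpha> x. x + \<alpha>"
  by simp

definition open_arc :: "real \<Rightarrow> real \<Rightarrow> circle set"
  where "open_arc a l = circle_of ` {a<..<a + l}"

text \<open>Continuous lifts to the real line of circle maps of degree one. All orientation preserving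
  homeomorphisms, and all monotone maps collapsing arcs, have such a lift.\<close>

definition is_lift :: "(real \<Rightarrow> real) \<Rightarrow> (circle \<Rightarrow> circle) \<Rightarrow> bool"
  where "is_lift F f \<longleftrightarrow> continuous_on UNIV F \<and> (\<forall>x. F (x + 1) = F x + 1)
    \<and> (\<forall>x. f (circle_of x) = circle_of (F x))"

definition has_circle_derivative :: "(circle \<Rightarrow> circle) \<Rightarrow> real \<Rightarrow> circle \<Rightarrow> bool"
  where "has_circle_derivative f D p \<longleftrightarrow>
    (\<exists>F x. is_lift F f \<and> circle_of x = p \<and> (F has_real_derivative D) (at x))"

text \<open>Positivity of the derivative makes \<open>f\<close> orientation preserving and its inverse
  continuously differentiable.\<close>

definition orientation_preserving_diffeo :: "real \<Rightarrow> (circle \<Rightarrow> circle) \<Rightarrow> bool"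
  where "orientation_preserving_diffeo \<delta> f \<longleftrightarrow> bij f \<and>
    (\<exists>f'. (\<forall>p. has_circle_derivative f (f' p) p \<and> 0 < f' p) \<and>
          (\<exists>C. \<forall>p q. \<bar>f' p - f' q\<bar> \<le> C * dist p q powr \<delta>))"


section \<open>Denjoy maps\<close>

text \<open>The lower limit is over \<open>\<bar>n\<bar> \<longrightarrow> \<infinity>\<close>. Since \<open>ln 0 = 0\<close> for the library logarithm, the
  value \<open>1 + \<delta>\<close> of the lower limit forces \<open>len n \<noteq> len (n + 1)\<close> for all but finitely many \<open>n\<close>, so
  both logarithms are genuine wherever they matter.\<close>

definition denjoy_sequence :: "real \<Rightarrow> (int \<Rightarrow> real) \<Rightarrow> bool"
  where "denjoy_sequence \<delta> len \<longleftrightarrow> (\<forall>n. 0 < len n) \<and> (len has_sum 1) UNIV \<and>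
    Liminf (sup at_bot at_top) (\<lambda>n. ereal (ln \<bar>len n - len (n + 1)\<bar> / ln (len n))) = ereal (1 + \<delta>)"

text \<open>The conditions on preimages say that \<open>h\<close> collapses exactly the closure of \<open>J n\<close> to the
  point \<open>n \<alpha>\<close> and is injective elsewhere. Together with monotonicity they place the arcs in the
  cyclic order of the points \<open>n \<alpha>\<close>.\<close>

definition denjoy_semiconjugacy ::
    "real \<Rightarrow> (int \<Rightarrow> circle set) \<Rightarrow> (circle \<Rightarrow> circle) \<Rightarrow> (circle \<Rightarrow> circle) \<Rightarrow> bool"
  where "denjoy_semiconjugacy \<alpha> J f h \<longleftrightarrow>
    (\<exists>H. is_lift H h \<and> mono H) \<and> surj h \<and>
    (\<forall>n. h -` {circle_of (of_int n * \<alpha>)} = closure (J n)) \<and>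
    inj_on h (- (\<Union>n. closure (J n))) \<and>
    h \<circ> f = rotation \<alpha> \<circ> h"

definition denjoy_map ::
    "real \<Rightarrow> real \<Rightarrow> (int \<Rightarrow> real) \<Rightarrow> (int \<Rightarrow> circle set) \<Rightarrow> (circle \<Rightarrow> circle) \<Rightarrow> bool"
  where "denjoy_map \<delta> \<alpha> len J f \<longleftrightarrow>
    (\<forall>n. \<exists>a. J n = open_arc a (len n)) \<and> disjoint_family J \<and>
    orientation_preserving_diffeo \<delta> f \<and>
    (\<forall>n. f ` J n = J (n + 1)) \<and>
    (\<forall>n. \<forall>p \<in> frontier (J n). has_circle_derivative f 1 p) \<and>
    (\<exists>h. denjoy_semiconjugacy \<alpha> J f h)"

definition denjoy_minimal_set :: "(int \<Rightarrow> circle set) \<Rightarrow> circle set"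
  where "denjoy_minimal_set J = - (\<Union>n. J n)"


section \<open>Continued fraction denominators\<close>

definition gauss_map :: "real \<Rightarrow> real"
  where "gauss_map x = frac (1 / x)"

text \<open>\<open>cf_coeff \<alpha> n\<close> is the partial quotient \<open>a\<^sub>n\<close> of \<open>\<alpha> = [a\<^sub>1, a\<^sub>2, \<dots>] \<in> (0, 1)\<close>, for \<open>n \<ge> 1\<close>.\<close>

definition cf_coeff :: "real \<Rightarrow> nat \<Rightarrow> nat"
  where "cf_coeff \<alpha> n = nat \<lfloor>1 / (gauss_map ^^ (n - 1)) \<alpha>\<rfloor>"

text \<open>The second equation is the general recursion with \<open>q\<^sub>-\<^sub>1 = 0\<close> and \<open>q\<^sub>0 = 1\<close>.\<close>

fun cf_denom :: "real \<Rightarrow> nat \<Rightarrow> nat"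
  where
    "cf_denom \<alpha> 0 = 1"
  | "cf_denom \<alpha> (Suc 0) = cf_coeff \<alpha> 1"
  | "cf_denom \<alpha> (Suc (Suc n)) = cf_coeff \<alpha> (n + 2) * cf_denom \<alpha> (Suc n) + cf_denom \<alpha> n"

definition cf_Q :: "real \<Rightarrow> nat \<Rightarrow> int"
  where "cf_Q \<alpha> n = int (cf_denom \<alpha> n + cf_denom \<alpha> (n + 1))"

definition cf_N :: "real \<Rightarrow> nat \<Rightarrow> int"
  where "cf_N \<alpha> n = \<lfloor>real (cf_denom \<alpha> n + cf_denom \<alpha> (n + 1)) / 2\<rfloor>"


section \<open>Hausdorff measure\<close>

text \<open>Covering sets are required to be bounded because the library \<open>diameter\<close> of an unbounded
  set is not meaningful; on the circle every set is bounded. The exponent is meant to be positive: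
  then \<open>0 powr \<beta> = 0\<close>, so empty sets and points contribute nothing.\<close>

definition hausdorff_content :: "real \<Rightarrow> real \<Rightarrow> 'a::metric_space set \<Rightarrow> ennreal"
  where "hausdorff_content \<beta> r Y =
    (INF U \<in> {U :: nat \<Rightarrow> 'a set. (\<forall>k. bounded (U k) \<and> diameter (U k) < r) \<and> Y \<subseteq> (\<Union>k. U k)}.
       \<Sum>k. ennreal (diameter (U k) powr \<beta>))"

definition hausdorff_measure :: "real \<Rightarrow> 'a::metric_space set \<Rightarrow> ennreal"
  where "hausdorff_measure \<beta> Y = Lim (at_right 0) (\<lambda>r. hausdorff_content \<beta> r Y)"

end

theory Submission
  imports Defs
begin

text \<open>The three bounds are instances of a mass distribution argument, the mass being Lebesgue measure
  pulled back along the semiconjugacy \<open>h\<close>. Lift \<open>h\<close> to a monotone map \<open>H\<close> of the line and let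
  \<open>\<eta>\<^sub>n = \<bar>q\<^sub>n \<alpha> - p\<^sub>n\<bar>\<close> (below \<open>gauss_prod \<alpha> n\<close>).
  A covering set \<open>U\<close> of small diameter \<open>d\<close> lies in an arc of length at most \<open>d\<close>, which \<open>H\<close> maps onto an
  interval of some small length \<open>t\<close>. Whenever \<open>i \<alpha>\<close> lies inside that interval modulo one, the whole
  gap \<open>J i\<close> lies in the arc, so \<open>d\<close> is at least the total length of the gaps visited in this way
  (\<open>sum_len_le\<close>).

  If \<open>t > 0\<close>, choose \<open>n\<close> with \<open>\<eta>\<^sub>n < t \<le> \<eta>\<^sub>n\<^sub>-\<^sub>1 \<le> 1 / q\<^sub>n\<close>. Among any \<open>q\<^sub>n + q\<^sub>n\<^sub>+\<^sub>1\<close> consecutive indices one is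
  visited (\<open>consecutive_visit\<close>), hence \<open>d \<ge> S\<^sub>n\<close>, where \<open>S\<^sub>n\<close> is a minimum over one window of that many
  indices, or a supremum of sums of minima over disjoint windows. If \<open>q\<^sub>n S\<^sub>n\<^sup>\<beta> \<ge> c\<close> for all large \<open>n\<close>, then
  \<open>d\<^sup>\<beta> \<ge> c / q\<^sub>n \<ge> c t\<close>. The images of the covering sets cover the circle, so the lengths \<open>t\<close> add up
  to at least 1, and the sum of the \<open>d\<^sup>\<beta>\<close> is at least \<open>c\<close>. This gives (a) and (c).

  In (b) neighbouring windows share an endpoint \<open>(2 l + 1) N\<^sub>n\<close>, and a gap visited there may be the only
  one available to both windows. The loss for a single covering set is at most the sum of the window
  minima \<open>m\<^sub>l\<close> over those \<open>l\<close> with \<open>(2 l + 1) N\<^sub>n\<close> visited, and it need not be small. It is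
  small for most sets: if it exceeds \<open>\<epsilon> \<Sum>\<^sub>l m\<^sub>l\<close>, then every point of the image of \<open>U\<close> is
  within \<open>1 / q\<^sub>n\<close> of points \<open>(2 l + 1) N\<^sub>n \<alpha>\<close> whose weights \<open>m\<^sub>l\<close> add up to more than that. By Markov's
  inequality such points form a set of measure at most \<open>2 / (\<epsilon> q\<^sub>n)\<close> (\<open>heavy_points\<close>). Since
  \<open>\<Sum>\<^sub>n 1 / q\<^sub>n\<close> converges, the exceptional sets of all large \<open>n\<close> together have small measure, and the mass
  distribution argument survives outside of them. This is why \<open>hausdorff_measure_ge\<close> allows exceptional
  sets \<open>E\<^sub>n\<close>.\<close>

section \<open>Gaps between the points of a rotation orbit\<close>

text \<open>This is \<open>\<bar>q\<^sub>n \<alpha> - p\<^sub>n\<bar>\<close>, the distance from \<open>q\<^sub>n \<alpha>\<close> to its convergent numerator; the product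
  formula makes positivity and monotonicity evident.\<close>

definition gauss_prod :: "real \<Rightarrow> nat \<Rightarrow> real"
  where "gauss_prod \<alpha> n = (\<Prod>i\<le>n. (gauss_map ^^ i) \<alpha>)"

lemma gauss_map_irrational:
  assumes "x \<notin> \<rat>"
  shows "gauss_map x \<notin> \<rat> \<and> 0 < gauss_map x \<and> gauss_map x < 1"
proof -
  have "1 / x \<notin> \<rat>"
    using assms Rats_divide[of 1 "1 / x"] by auto
  then have irr: "gauss_map x \<notin> \<rat>"
    unfolding gauss_map_def frac_def
    using Rats_add[OF _ Rats_of_int, of "1 / x - of_int \<lfloor>1 / x\<rfloor>" "\<lfloor>1 / x\<rfloor>"] by auto
  then have "gauss_map x \<noteq> 0"
    by auto
  then show ?thesis
    using irr frac_ge_0[of "1 / x"] frac_lt_1[of "1 / x"] unfolding gauss_map_def by auto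
qed

lemma gauss_orbit_bounds:
  fixes \<alpha> :: real
  assumes "0 < \<alpha>" "\<alpha> < 1" "\<alpha> \<notin> \<rat>"
  shows "0 < (gauss_map ^^ n) \<alpha>" "(gauss_map ^^ n) \<alpha> < 1"
proof -
  have "(gauss_map ^^ n) \<alpha> \<notin> \<rat> \<and> 0 < (gauss_map ^^ n) \<alpha> \<and> (gauss_map ^^ n) \<alpha> < 1"
    by (induction n) (use assms gauss_map_irrational in auto)
  then show "0 < (gauss_map ^^ n) \<alpha>" "(gauss_map ^^ n) \<alpha> < 1"
    by auto
qed

lemma gauss_map_step:
  fixes \<alpha> :: real
  assumes "0 < \<alpha>" "\<alpha> < 1" "\<alpha> \<notin> \<rat>"
  shows "(gauss_map ^^ n) \<alpha> * (gauss_map ^^ Suc n) \<alpha> = 1 - cf_coeff \<alpha> (Suc n) * (gauss_map ^^ n) \<alpha>"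
proof -
  have "0 < (gauss_map ^^ n) \<alpha>"
    using gauss_orbit_bounds[OF assms] by blast
  then show ?thesis
    by (simp add: gauss_map_def cf_coeff_def frac_def field_simps)
qed

lemma cf_coeff_pos:
  fixes \<alpha> :: real
  assumes "0 < \<alpha>" "\<alpha> < 1" "\<alpha> \<notin> \<rat>"
  shows "1 \<le> cf_coeff \<alpha> (Suc n)"
proof -
  have "1 \<le> 1 / (gauss_map ^^ n) \<alpha>"
    using gauss_orbit_bounds[OF assms, of n] by simp
  then have "1 \<le> \<lfloor>1 / (gauss_map ^^ n) \<alpha>\<rfloor>"
    by linarith
  then show ?thesis
    using nat_mono[of 1] unfolding cf_coeff_def by simp
qed

lemma gauss_prod_bounds:
  fixes \<alpha> :: real
  assumes "0 < \<alpha>" "\<alpha> < 1" "\<alpha> \<notin> \<rat>"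
  shows "0 < gauss_prod \<alpha> n" "gauss_prod \<alpha> (Suc n) \<le> gauss_prod \<alpha> n"
proof -
  note g = gauss_orbit_bounds[OF assms]
  show pos: "0 < gauss_prod \<alpha> n"
    unfolding gauss_prod_def using g by (intro prod_pos) auto
  have "gauss_prod \<alpha> n * (gauss_map ^^ Suc n) \<alpha> \<le> gauss_prod \<alpha> n"
    using pos g(2)[of "Suc n"] by (intro mult_left_le) auto
  then show "gauss_prod \<alpha> (Suc n) \<le> gauss_prod \<alpha> n"
    by (simp add: gauss_prod_def)
qed

lemma gauss_prod_rec:
  fixes \<alpha> :: real
  assumes "0 < \<alpha>" "\<alpha> < 1" "\<alpha> \<notin> \<rat>"
  shows "gauss_prod \<alpha> 0 = \<alpha>" "gauss_prod \<alpha> (Suc 0) = 1 - cf_coeff \<alpha> 1 * \<alpha>"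
    "gauss_prod \<alpha> (Suc (Suc n)) = gauss_prod \<alpha> n - cf_coeff \<alpha> (n + 2) * gauss_prod \<alpha> (Suc n)"
proof -
  note step = gauss_map_step[OF assms]
  show "gauss_prod \<alpha> 0 = \<alpha>" "gauss_prod \<alpha> (Suc 0) = 1 - cf_coeff \<alpha> 1 * \<alpha>"
    using step[of 0] by (simp_all add: gauss_prod_def)
  have "gauss_prod \<alpha> (Suc (Suc n))
      = gauss_prod \<alpha> n * ((gauss_map ^^ Suc n) \<alpha> * (gauss_map ^^ Suc (Suc n)) \<alpha>)"
    by (simp add: gauss_prod_def)
  also have "\<dots> = gauss_prod \<alpha> n - cf_coeff \<alpha> (n + 2) * gauss_prod \<alpha> (Suc n)"
    unfolding step by (simp add: gauss_prod_def algebra_simps)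
  finally show "gauss_prod \<alpha> (Suc (Suc n)) = \<dots>" .
qed

lemma cf_denom_gauss_prod_identity:
  fixes \<alpha> :: real
  assumes "0 < \<alpha>" "\<alpha> < 1" "\<alpha> \<notin> \<rat>"
  shows "cf_denom \<alpha> (Suc n) * gauss_prod \<alpha> n + cf_denom \<alpha> n * gauss_prod \<alpha> (Suc n) = 1"
  by (induction n) (simp_all add: gauss_prod_rec[OF assms] algebra_simps)

text \<open>The signs alternate with \<open>n\<close>. It is this alternation that lets \<open>q\<^sub>n\<close> and \<open>q\<^sub>n\<^sub>+\<^sub>1\<close> move a point of the
  orbit to the right by adding the one to its index or subtracting the other.\<close>

lemma cf_denom_mult_mod_one:
  fixes \<alpha> :: real
  assumes "0 < \<alpha>" "\<alpha> < 1" "\<alpha> \<notin> \<rat>"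
  shows "\<exists>p::int. cf_denom \<alpha> n * \<alpha> - of_int p = (-1) ^ n * gauss_prod \<alpha> n"
proof (induction n rule: induct_nat_012)
  case 0
  show ?case
    by (rule exI[of _ 0]) (simp add: gauss_prod_rec[OF assms])
next
  case 1
  show ?case
    by (rule exI[of _ 1]) (simp add: gauss_prod_rec[OF assms])
next
  case (ge2 n)
  then obtain p p' :: int
    where "cf_denom \<alpha> n * \<alpha> - p = (-1) ^ n * gauss_prod \<alpha> n"
      and "cf_denom \<alpha> (Suc n) * \<alpha> - p' = (-1) ^ Suc n * gauss_prod \<alpha> (Suc n)"
    by blast
  then have eq: "gauss_prod \<alpha> n = (-1) ^ n * (cf_denom \<alpha> n * \<alpha> - p)"
    "gauss_prod \<alpha> (Suc n) = (-1) ^ Suc n * (cf_denom \<alpha> (Suc n) * \<alpha> - p')"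
    by (cases "even n"; simp)+
  show ?case
    by (rule exI[of _ "int (cf_coeff \<alpha> (n + 2)) * p' + p"])
      (simp add: gauss_prod_rec(3)[OF assms] eq algebra_simps)
qed

lemma cf_denom_pos:
  fixes \<alpha> :: real
  assumes "0 < \<alpha>" "\<alpha> < 1" "\<alpha> \<notin> \<rat>"
  shows "0 < cf_denom \<alpha> n"
  using cf_coeff_pos[OF assms, of 0] by (induction n rule: induct_nat_012) auto

lemma cf_denom_double:
  fixes \<alpha> :: real
  assumes "0 < \<alpha>" "\<alpha> < 1" "\<alpha> \<notin> \<rat>"
  shows "2 * cf_denom \<alpha> n \<le> cf_denom \<alpha> (Suc (Suc n))"
proof -
  have mono: "cf_denom \<alpha> n \<le> cf_denom \<alpha> (Suc n)"
  proof (cases n)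
    case 0
    then show ?thesis
      using cf_coeff_pos[OF assms, of 0] by simp
  next
    case (Suc k)
    have "1 * cf_denom \<alpha> (Suc k) \<le> cf_coeff \<alpha> (k + 2) * cf_denom \<alpha> (Suc k)"
      using cf_coeff_pos[OF assms, of "Suc k"] by (intro mult_right_mono) auto
    then show ?thesis
      unfolding Suc cf_denom.simps by linarith
  qed
  have "1 * cf_denom \<alpha> (Suc n) \<le> cf_coeff \<alpha> (n + 2) * cf_denom \<alpha> (Suc n)"
    using cf_coeff_pos[OF assms, of "Suc n"] by (intro mult_right_mono) auto
  with mono show ?thesis
    unfolding cf_denom.simps by linarith
qed

text \<open>Doubling every two steps makes the denominators grow at least like powers of \<open>sqrt 2\<close>.\<close>

lemma summable_inverse_cf_denom:
  fixes \<alpha> :: real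
  assumes "0 < \<alpha>" "\<alpha> < 1" "\<alpha> \<notin> \<rat>"
  shows "summable (\<lambda>n. 1 / real (cf_denom \<alpha> n))"
proof -
  note pos = cf_denom_pos[OF assms]
  have lower: "sqrt 2 ^ n \<le> sqrt 2 * cf_denom \<alpha> n" for n
  proof (induction n rule: induct_nat_012)
    case 0
    show ?case by simp
  next
    case 1
    show ?case using pos[of 1] by simp
  next
    case (ge2 n)
    have "sqrt 2 ^ Suc (Suc n) = 2 * sqrt 2 ^ n"
      by simp
    also have "\<dots> \<le> sqrt 2 * real (2 * cf_denom \<alpha> n)"
      using ge2 by simp
    also have "\<dots> \<le> sqrt 2 * cf_denom \<alpha> (Suc (Suc n))"
      using cf_denom_double[OF assms, of n] by (intro mult_left_mono of_nat_mono) auto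
    finally show ?case .
  qed
  have geo: "summable (\<lambda>n. sqrt 2 * (1 / sqrt 2) ^ n)"
    by (intro summable_mult summable_geometric) auto
  show ?thesis
  proof (rule summable_comparison_test'[OF geo])
    fix n :: nat
    show "norm (1 / real (cf_denom \<alpha> n)) \<le> sqrt 2 * (1 / sqrt 2) ^ n"
      using lower[of n] pos[of n] by (simp add: field_simps)
  qed
qed

lemma gauss_prod_le:
  fixes \<alpha> :: real
  assumes "0 < \<alpha>" "\<alpha> < 1" "\<alpha> \<notin> \<rat>"
  shows "gauss_prod \<alpha> n \<le> 1 / cf_denom \<alpha> (Suc n)"
proof -
  have "0 \<le> cf_denom \<alpha> n * gauss_prod \<alpha> (Suc n)"
    using gauss_prod_bounds(1)[OF assms] by (simp add: less_imp_le)
  then show ?thesis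
    using cf_denom_gauss_prod_identity[OF assms, of n] cf_denom_pos[OF assms, of "Suc n"]
    by (simp add: field_simps)
qed

lemma gauss_prod_tendsto_0:
  fixes \<alpha> :: real
  assumes "0 < \<alpha>" "\<alpha> < 1" "\<alpha> \<notin> \<rat>"
  shows "gauss_prod \<alpha> \<longlonglongrightarrow> 0"
proof (rule tendsto_sandwich[where f = "\<lambda>_. 0"])
  show "(\<lambda>n. 1 / real (cf_denom \<alpha> (Suc n))) \<longlonglongrightarrow> 0"
    using LIMSEQ_Suc[OF summable_LIMSEQ_zero[OF summable_inverse_cf_denom[OF assms]]] .
qed (use gauss_prod_le[OF assms] gauss_prod_bounds(1)[OF assms] in \<open>auto simp: less_imp_le\<close>)

definition visits :: "real \<Rightarrow> real \<Rightarrow> real \<Rightarrow> int set"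
  where "visits \<alpha> u v = {i. \<exists>m::int. u < of_int i * \<alpha> + of_int m \<and> of_int i * \<alpha> + of_int m < v}"

text \<open>The easy half of the three gap theorem. Of \<open>q\<^sub>n\<close> and \<open>q\<^sub>n\<^sub>+\<^sub>1\<close>, one rotates to the right and the other to
  the left, by at most \<open>gauss_prod \<alpha> n\<close>. So adding the former or subtracting the latter moves right, and since there
  are \<open>q\<^sub>n + q\<^sub>n\<^sub>+\<^sub>1\<close> indices, one of the two stays in range.\<close>

lemma next_orbit_point:
  fixes i :: int and \<alpha> :: real
  assumes \<alpha>: "0 < \<alpha>" "\<alpha> < 1" "\<alpha> \<notin> \<rat>"
    and "0 \<le> i" "i < cf_Q \<alpha> n"
  obtains i' m :: int where "0 \<le> i'" "i' < cf_Q \<alpha> n"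
    "i * \<alpha> < i' * \<alpha> + m" "i' * \<alpha> + m \<le> i * \<alpha> + gauss_prod \<alpha> n"
proof -
  define q q' where "q = int (cf_denom \<alpha> n)" and "q' = int (cf_denom \<alpha> (Suc n))"
  obtain p p' :: int where p: "cf_denom \<alpha> n * \<alpha> - p = (-1) ^ n * gauss_prod \<alpha> n"
    and p': "cf_denom \<alpha> (Suc n) * \<alpha> - p' = (-1) ^ Suc n * gauss_prod \<alpha> (Suc n)"
    using cf_denom_mult_mod_one[OF \<alpha>] by meson
  have Q: "cf_Q \<alpha> n = q + q'" and nonneg: "0 \<le> q" "0 \<le> q'"
    by (simp_all add: cf_Q_def q_def q'_def)
  note g = gauss_prod_bounds(1)[OF \<alpha>, of n] gauss_prod_bounds(1)[OF \<alpha>, of "Suc n"]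
    gauss_prod_bounds(2)[OF \<alpha>, of n]
  show thesis
  proof (cases "even n")
    case True
    then have D: "q * \<alpha> = p + gauss_prod \<alpha> n" "q' * \<alpha> = p' - gauss_prod \<alpha> (Suc n)"
      using p p' by (simp_all add: q_def q'_def)
    show thesis
    proof (cases "i < q'")
      case True
      then show thesis
        using assms Q nonneg D g by (intro that[of "i + q" "- p"]) (auto simp: algebra_simps)
    next
      case False
      then show thesis
        using assms Q nonneg D g by (intro that[of "i - q'" p']) (auto simp: algebra_simps)
    qed
  next
    case False
    then have D: "q * \<alpha> = p - gauss_prod \<alpha> n" "q' * \<alpha> = p' + gauss_prod \<alpha> (Suc n)"
      using p p' by (simp_all add: q_def q'_def)
    show thesis
    proof (cases "i < q")
      case True
      then show thesis
        using assms Q nonneg D g by (intro that[of "i + q'" "- p'"]) (auto simp: algebra_simps)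
    next
      case False
      then show thesis
        using assms Q nonneg D g by (intro that[of "i - q" p]) (auto simp: algebra_simps)
    qed
  qed
qed

text \<open>Follow \<open>next_orbit_point\<close> from the last orbit point not beyond \<open>u\<close>: its successor lies beyond \<open>u\<close> and
  within \<open>gauss_prod \<alpha> n\<close> of it, hence before \<open>v\<close>. Translating by \<open>j \<alpha>\<close> reduces to the indices
  from \<open>0\<close> on.\<close>

lemma consecutive_visit:
  fixes j :: int and \<alpha> u v :: real
  assumes \<alpha>: "0 < \<alpha>" "\<alpha> < 1" "\<alpha> \<notin> \<rat>"
    and long: "gauss_prod \<alpha> n < v - u"
  shows "\<exists>i \<in> visits \<alpha> u v. j \<le> i \<and> i < j + cf_Q \<alpha> n"
proof -
  define Q where "Q = cf_Q \<alpha> n"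
  define w where "w = u - j * \<alpha>"
  \<comment> \<open>the translate of \<open>i \<alpha>\<close> by an integer that comes last before \<open>w\<close>\<close>
  define g where "g i = i * \<alpha> + \<lfloor>w - i * \<alpha>\<rfloor>" for i :: int
  have "0 < Q"
    using cf_denom_pos[OF \<alpha>, of n] by (simp add: Q_def cf_Q_def)
  then have "finite (g ` {0..<Q})" "g ` {0..<Q} \<noteq> {}"
    by auto
  then have "Max (g ` {0..<Q}) \<in> g ` {0..<Q}"
    by (rule Max_in)
  then obtain i where i: "i \<in> {0..<Q}" "Max (g ` {0..<Q}) = g i"
    by blast
  then have top: "g k \<le> g i" if "k \<in> {0..<Q}" for k
    using that Max_ge[of "g ` {0..<Q}" "g k"] by auto
  obtain i' m :: int where i': "0 \<le> i'" "i' < Q"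
    and m: "i * \<alpha> < i' * \<alpha> + m" "i' * \<alpha> + m \<le> i * \<alpha> + gauss_prod \<alpha> n"
    using next_orbit_point[OF \<alpha>, of i n] i unfolding Q_def by auto
  define k where "k = m + \<lfloor>w - i * \<alpha>\<rfloor>"
  have "g i \<le> w"
    unfolding g_def by linarith
  then have below: "i' * \<alpha> + k < w + (v - u)"
    using m(2) long unfolding g_def k_def by simp
  have above: "w < i' * \<alpha> + k"
  proof (rule ccontr)
    assume "\<not> w < i' * \<alpha> + k"
    then have "k \<le> \<lfloor>w - i' * \<alpha>\<rfloor>"
      by (simp add: le_floor_iff)
    then have "i' * \<alpha> + k \<le> g i'"
      by (simp add: g_def)
    moreover have "g i < i' * \<alpha> + k"
      using m(1) unfolding g_def k_def by simp
    ultimately show False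
      using top[of i'] i' by auto
  qed
  have "u < (i' + j) * \<alpha> + k" "(i' + j) * \<alpha> + k < v"
    using above below unfolding w_def by (simp_all add: algebra_simps)
  then have "i' + j \<in> visits \<alpha> u v"
    unfolding visits_def by blast
  then show ?thesis
    using i' unfolding Q_def by (intro bexI[of _ "i' + j"]) auto
qed

section \<open>Hausdorff measure and Lebesgue measure modulo one\<close>

lemma le_of_liminf:
  assumes "\<And>c n1. 0 < c \<Longrightarrow> (\<And>n. n \<ge> n1 \<Longrightarrow> c < x n) \<Longrightarrow> ennreal c \<le> y"
  shows "liminf (\<lambda>n. ennreal (x n)) \<le> y"
proof (rule dense_le)
  fix z assume z: "z < liminf (\<lambda>n. ennreal (x n))"
  then obtain c where c: "0 \<le> c" "z = ennreal c"
    by (cases z) auto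
  have "eventually (\<lambda>n. z < ennreal (x n)) sequentially"
    using z by (rule less_LiminfD)
  then obtain n1 where n1: "\<And>n. n \<ge> n1 \<Longrightarrow> c < x n"
    unfolding c eventually_sequentially using c(1) by (auto simp: ennreal_less_iff)
  show "z \<le> y"
    using c assms[of c n1] n1 by (cases "c = 0") auto
qed

text \<open>The content decreases in \<open>r\<close>, so the limit exists and is a supremum.\<close>

lemma hausdorff_content_le_measure:
  assumes "0 < r"
  shows "hausdorff_content \<beta> r (Y :: 'a::metric_space set) \<le> hausdorff_measure \<beta> Y"
proof -
  let ?c = "\<lambda>r. hausdorff_content \<beta> r Y"
  have anti: "?c r' \<le> ?c r" if "r \<le> r'" for r r'
    unfolding hausdorff_content_def
  proof (rule INF_superset_mono[OF subsetI])
    fix U :: "nat \<Rightarrow> 'a set"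
    assume U: "U \<in> {U. (\<forall>k. bounded (U k) \<and> diameter (U k) < r) \<and> Y \<subseteq> (\<Union>k. U k)}"
    have "diameter (U k) < r'" for k
      using U that by (intro less_le_trans[of _ r r']) blast+
    with U show "U \<in> {U. (\<forall>k. bounded (U k) \<and> diameter (U k) < r') \<and> Y \<subseteq> (\<Union>k. U k)}"
      by blast
  qed simp
  have "(?c \<longlongrightarrow> (SUP r\<in>{0<..}. ?c r)) (at_right 0)"
  proof (rule order_tendstoI)
    fix a assume "a < (SUP r\<in>{0<..}. ?c r)"
    then obtain r0 where "0 < r0" "a < ?c r0"
      by (auto simp: less_SUP_iff)
    have "a < ?c r" if "r \<in> {0<..<r0}" for r
      using \<open>a < ?c r0\<close> anti[of r r0] that by (intro less_le_trans[of a "?c r0" "?c r"]) auto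
    then show "\<forall>\<^sub>F r in at_right 0. a < ?c r"
      using \<open>0 < r0\<close> by (rule eventually_at_rightI)
  next
    fix a assume a: "(SUP r\<in>{0<..}. ?c r) < a"
    have "?c r < a" if "r \<in> {0<..<1}" for r
      using a that by (intro le_less_trans[OF SUP_upper[of r "{0<..}" ?c]]) auto
    then show "\<forall>\<^sub>F r in at_right 0. ?c r < a"
      using zero_less_one by (rule eventually_at_rightI)
  qed
  then have "hausdorff_measure \<beta> Y = (SUP r\<in>{0<..}. ?c r)"
    unfolding hausdorff_measure_def by (intro tendsto_Lim trivial_limit_at_right_real)
  then show ?thesis
    using assms by (auto intro: SUP_upper)
qed

text \<open>The image of \<open>{u..v}\<close> under \<open>frac\<close>, written as a countable union to make its measurability plain.\<close>

definition fold_mod_one :: "real \<Rightarrow> real \<Rightarrow> real set"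
  where "fold_mod_one u v = {0..<1} \<inter> (\<Union>m::int. {u - m..v - m})"

lemma sets_fold_mod_one [measurable]: "fold_mod_one u v \<in> sets lborel"
  unfolding fold_mod_one_def by measurable

lemma emeasure_fold_mod_one_le:
  assumes "u \<le> v"
  shows "emeasure lborel (fold_mod_one u v) \<le> ennreal (v - u)"
proof (cases "v - u < 1")
  case False
  have "emeasure lborel (fold_mod_one u v) \<le> emeasure lborel {0..<1::real}"
    unfolding fold_mod_one_def by (intro emeasure_mono) auto
  also have "\<dots> \<le> ennreal (v - u)"
    using False by (simp flip: ennreal_1 add: ennreal_leI)
  finally show ?thesis .
next
  case True
  define k where "k = \<lfloor>u\<rfloor>"
  define T1 T2 where "T1 = {u - k..min 1 (v - k)}" and "T2 = {0..v - k - 1}"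
  have k: "k \<le> u" "u < k + 1"
    unfolding k_def by linarith+
  have "fold_mod_one u v \<subseteq> T1 \<union> T2"
  proof
    fix y assume "y \<in> fold_mod_one u v"
    then obtain m :: int where y: "0 \<le> y" "y < 1" "u - m \<le> y" "y \<le> v - m"
      unfolding fold_mod_one_def by auto
    then have "k - 1 < real_of_int m" "real_of_int m < k + 2"
      using k True by linarith+
    then have "m = k \<or> m = k + 1"
      by linarith
    then show "y \<in> T1 \<union> T2"
      using y unfolding T1_def T2_def by auto
  qed
  then have "emeasure lborel (fold_mod_one u v) \<le> emeasure lborel (T1 \<union> T2)"
    unfolding T1_def T2_def by (intro emeasure_mono) auto
  also have "\<dots> \<le> emeasure lborel T1 + emeasure lborel T2"
    unfolding T1_def T2_def by (intro emeasure_subadditive) auto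
  also have "\<dots> \<le> ennreal (v - u)"
  proof (cases "v - k \<le> 1")
    case True
    then have "emeasure lborel T1 = ennreal (v - u)" "emeasure lborel T2 = 0"
      using assms unfolding T1_def T2_def by (auto simp: emeasure_lborel_Icc_eq)
    then show ?thesis
      by simp
  next
    case False
    then have "emeasure lborel T1 = ennreal (1 - (u - k))" "emeasure lborel T2 = ennreal (v - k - 1)"
      using k unfolding T1_def T2_def by (auto simp: emeasure_lborel_Icc_eq)
    then show ?thesis
      using k False by (simp flip: ennreal_plus)
  qed
  finally show ?thesis .
qed


text \<open>Markov's inequality: a point in the \<open>\<rho>\<close>-neighbourhoods of many of the weighted points \<open>x l\<close> is rare, because
  each neighbourhood has measure at most \<open>2 \<rho>\<close>.\<close>

lemma heavy_points:
  fixes w x :: "'i \<Rightarrow> real"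
  assumes "finite F" and w: "\<And>l. l \<in> F \<Longrightarrow> 0 \<le> w l" and "0 < a" "0 \<le> \<rho>"
  defines "E \<equiv> {y \<in> {0..<1}. a \<le> (\<Sum>l\<in>F. w l * indicator (fold_mod_one (x l - \<rho>) (x l + \<rho>)) y)}"
  shows "E \<in> sets lborel" "emeasure lborel E \<le> ennreal (2 * \<rho> * sum w F / a)"
proof -
  let ?T = "\<lambda>l. fold_mod_one (x l - \<rho>) (x l + \<rho>)"
  define g where "g y = (\<Sum>l\<in>F. w l * indicator (?T l) y)" for y :: real
  have [measurable]: "g \<in> borel_measurable lborel"
    unfolding g_def by measurable
  have E: "E = {y \<in> {0..<1}. a \<le> g y}"
    unfolding E_def g_def ..
  show E_sets: "E \<in> sets lborel"
  proof -
    have "E = {0..<1} \<inter> {y \<in> space lborel. a \<le> g y}"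
      unfolding E by auto
    then show ?thesis by simp
  qed
  have g_nn: "0 \<le> g y" for y
    unfolding g_def using w by (intro sum_nonneg) auto
  have "emeasure lborel E = (\<integral>\<^sup>+y. indicator E y \<partial>lborel)"
    using E_sets by simp
  also have "\<dots> \<le> (\<integral>\<^sup>+y. ennreal (g y / a) \<partial>lborel)"
    using \<open>0 < a\<close> g_nn
    by (intro nn_integral_mono) (auto simp: E indicator_def simp flip: ennreal_1 intro!: ennreal_leI)
  also have "\<dots> = (\<integral>\<^sup>+y. (\<Sum>l\<in>F. ennreal (w l / a) * indicator (?T l) y) \<partial>lborel)"
  proof (intro nn_integral_cong)
    fix y :: real
    have "ennreal (g y / a) = ennreal (\<Sum>l\<in>F. w l / a * indicator (?T l) y)"
      unfolding g_def by (simp add: sum_divide_distrib)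
    also have "\<dots> = (\<Sum>l\<in>F. ennreal (w l / a * indicator (?T l) y))"
      using w \<open>0 < a\<close> by (intro sum_ennreal[symmetric]) auto
    also have "\<dots> = (\<Sum>l\<in>F. ennreal (w l / a) * indicator (?T l) y)"
      by (intro sum.cong refl) (simp add: indicator_def)
    finally show "ennreal (g y / a) = \<dots>" .
  qed
  also have "\<dots> = (\<Sum>l\<in>F. ennreal (w l / a) * emeasure lborel (?T l))"
    using sets_fold_mod_one by (subst nn_integral_sum) (auto simp: nn_integral_cmult_indicator)
  also have "\<dots> \<le> (\<Sum>l\<in>F. ennreal (w l / a) * ennreal (2 * \<rho>))"
  proof (intro sum_mono mult_left_mono)
    fix l
    show "emeasure lborel (?T l) \<le> ennreal (2 * \<rho>)"
      using emeasure_fold_mod_one_le[of "x l - \<rho>" "x l + \<rho>"] \<open>0 \<le> \<rho>\<close> by simp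
  qed simp
  also have "\<dots> = (\<Sum>l\<in>F. ennreal (w l / a * (2 * \<rho>)))"
    using w \<open>0 < a\<close> \<open>0 \<le> \<rho>\<close> by (intro sum.cong refl ennreal_mult[symmetric]) auto
  also have "\<dots> = ennreal (\<Sum>l\<in>F. w l / a * (2 * \<rho>))"
    using w \<open>0 < a\<close> \<open>0 \<le> \<rho>\<close> by (intro sum_ennreal) auto
  also have "(\<Sum>l\<in>F. w l / a * (2 * \<rho>)) = 2 * \<rho> * sum w F / a"
    by (simp add: sum_distrib_left sum_distrib_right sum_divide_distrib mult_ac)
  finally show "emeasure lborel E \<le> ennreal (2 * \<rho> * sum w F / a)" .
qed

section \<open>Lifting a collapse of the gaps to the line\<close>

lemma irrational_multiple_inj:
  fixes i j m m' :: int and \<alpha> :: real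
  assumes "\<alpha> \<notin> \<rat>" "of_int i * \<alpha> + of_int m = of_int j * \<alpha> + of_int m'"
  shows "i = j"
proof (rule ccontr)
  assume "i \<noteq> j"
  then have "\<alpha> = of_int (m' - m) / of_int (i - j)"
    using assms(2) by (simp add: field_simps)
  then show False
    using assms(1) by (metis Rats_divide Rats_of_int)
qed

lemma circle_of_eq_iff: "circle_of x = circle_of y \<longleftrightarrow> x - y \<in> \<int>"
  by (simp add: circle.abs_eq_iff)

lemma circle_of_cases: obtains x where "p = circle_of x"
  by (induction p rule: circle.abs_induct) auto

text \<open>Lift all points of \<open>U\<close> near one chosen lift. As \<open>U\<close> is small compared with the circle, arc distances
  between points of \<open>U\<close> are then distances on the line.\<close>

lemma lift_small_set:
  fixes U :: "circle set"
  assumes "bounded U" and small: "diameter U < 1 / 4"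
  obtains s s' where "s \<le> s'" "s' - s \<le> diameter U" "U \<subseteq> circle_of ` {s..s'}"
proof (cases "U = {}")
  case True
  then show thesis
    using that[of 0 0] by (simp add: diameter_def)
next
  case False
  then obtain p where "p \<in> U"
    by blast
  obtain x0 where "p = circle_of x0"
    by (rule circle_of_cases)
  with \<open>p \<in> U\<close> have x0: "circle_of x0 \<in> U"
    by simp
  have arc: "arc_dist x y \<le> diameter U" if "circle_of x \<in> U" "circle_of y \<in> U" for x y
    using diameter_bounded_bound[OF assms(1) that] by (simp add: dist_circle.abs_eq)
  define Y where "Y = {y. \<bar>y - x0\<bar> \<le> diameter U \<and> circle_of y \<in> U}"
  have diff: "\<bar>y - y'\<bar> \<le> diameter U" if "y \<in> Y" "y' \<in> Y" for y y'
  proof -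
    obtain k where k: "arc_dist y y' = \<bar>y - y' - of_int k\<bar>"
      using arc_dist_attained by blast
    then have le: "\<bar>y - y' - of_int k\<bar> \<le> diameter U"
      using arc[of y y'] that unfolding Y_def by auto
    \<comment> \<open>a nonzero \<open>k\<close> would force \<open>1 \<le> 3 * diameter U\<close>\<close>
    have "\<bar>y - y'\<bar> \<le> 2 * diameter U"
      using that unfolding Y_def by (simp add: abs_le_iff)
    then have "\<bar>real_of_int k\<bar> < 1"
      using le small by linarith
    then have "k = 0"
      by linarith
    then show ?thesis
      using le by simp
  qed
  have "x0 \<in> Y"
    using x0 diameter_ge_0[OF assms(1)] unfolding Y_def by simp
  have bdd: "bdd_below Y" "bdd_above Y"
    unfolding bdd_below_def bdd_above_def
    by (rule exI[of _ "x0 - diameter U"], simp add: Y_def abs_le_iff)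
      (rule exI[of _ "x0 + diameter U"], simp add: Y_def abs_le_iff)
  show thesis
  proof (rule that[of "Inf Y" "Sup Y"])
    show "Inf Y \<le> Sup Y"
      using cInf_lower[OF \<open>x0 \<in> Y\<close> bdd(1)] cSup_upper[OF \<open>x0 \<in> Y\<close> bdd(2)] by linarith
    have "Sup Y - diameter U \<le> y" if "y \<in> Y" for y
    proof -
      have "Sup Y \<le> y + diameter U"
        using \<open>x0 \<in> Y\<close> diff[of _ y] that by (intro cSup_least) (auto simp: abs_le_iff algebra_simps)
      then show ?thesis by simp
    qed
    then have "Sup Y - diameter U \<le> Inf Y"
      using \<open>x0 \<in> Y\<close> by (intro cInf_greatest) auto
    then show "Sup Y - Inf Y \<le> diameter U"
      by simp
    show "U \<subseteq> circle_of ` {Inf Y..Sup Y}"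
    proof
      fix q assume "q \<in> U"
      obtain y0 where y0: "q = circle_of y0"
        by (rule circle_of_cases)
      obtain k where k: "arc_dist y0 x0 = \<bar>y0 - x0 - of_int k\<bar>"
        using arc_dist_attained by blast
      have q: "q = circle_of (y0 - of_int k)"
        unfolding y0 circle_of_eq_iff by simp
      then have "y0 - of_int k \<in> Y"
        using arc[of y0 x0] k \<open>q \<in> U\<close> x0 y0 unfolding Y_def by (simp add: algebra_simps)
      then show "q \<in> circle_of ` {Inf Y..Sup Y}"
        using q bdd by (auto intro!: cInf_lower cSup_upper)
    qed
  qed
qed

lemma degree_one_shift_int:
  fixes H :: "real \<Rightarrow> real"
  assumes "\<And>x. H (x + 1) = H x + 1"
  shows "H (x + of_int m) = H x + of_int m"
proof (induction m rule: int_induct[where k = 0])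
  case (step1 i)
  then show ?case
    using assms[of "x + of_int i"] by (simp add: algebra_simps)
next
  case (step2 i)
  then show ?case
    using assms[of "x + of_int (i - 1)"] by (simp add: algebra_simps)
qed simp

text \<open>What the argument uses of a Denjoy map, on the line: \<open>H\<close> collapses a translate \<open>{b n..b n + len n}\<close> of each gap to the
  real number \<open>n \<alpha>\<close> itself, rather than to \<open>n \<alpha>\<close> plus some integer.\<close>

locale collapsed_gaps =
  fixes \<alpha> :: real and len b :: "int \<Rightarrow> real" and H :: "real \<Rightarrow> real" and \<Omega> :: "circle set"
  assumes \<alpha>: "0 < \<alpha>" "\<alpha> < 1" "\<alpha> \<notin> \<rat>"
    and len_pos: "0 < len n"
    and H_cont: "continuous_on UNIV H"
    and H_mono: "mono H"
    and H_shift: "H (x + 1) = H x + 1"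
    and H_gap: "b n \<le> x \<Longrightarrow> x \<le> b n + len n \<Longrightarrow> H x = of_int n * \<alpha>"
    and \<Omega>_onto: "\<exists>x. H x = y \<and> circle_of x \<in> \<Omega>"
begin

lemma H_shift_int: "H (x + of_int m) = H x + of_int m"
  using H_shift by (rule degree_one_shift_int)

lemma uniformly_continuous_collapse:
  assumes "0 < \<tau>"
  obtains r where "0 < r" "\<And>x y. x \<le> y \<Longrightarrow> y - x < r \<Longrightarrow> H y - H x < \<tau>"
proof -
  have "uniformly_continuous_on {0..2} H"
    using H_cont by (intro compact_uniformly_continuous) (auto intro: continuous_on_subset)
  then obtain d where d: "0 < d" "\<And>x y. x \<in> {0..2} \<Longrightarrow> y \<in> {0..2} \<Longrightarrow> dist y x < d \<Longrightarrow> dist (H y) (H x) < \<tau>"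
    using assms unfolding uniformly_continuous_on_def by metis
  show thesis
  proof (rule that[of "min d 1"])
    show "0 < min d 1"
      using d(1) by simp
    fix x y :: real assume xy: "x \<le> y" "y - x < min d 1"
    define k where "k = \<lfloor>x\<rfloor>"
    have k: "of_int k \<le> x" "x < of_int k + 1"
      unfolding k_def by linarith+
    have "dist (H (y - of_int k)) (H (x - of_int k)) < \<tau>"
      using xy k by (intro d(2)) (auto simp: dist_real_def)
    then show "H y - H x < \<tau>"
      using H_shift_int[of "y - of_int k" k] H_shift_int[of "x - of_int k" k]
      by (simp add: dist_real_def)
  qed
qed

text \<open>Each visited index contributes a full translate of its gap to \<open>{s..s'}\<close>, because \<open>H\<close> takes an interior
  value there; translates of gaps with distinct indices have distinct \<open>H\<close>-values and so are disjoint.\<close>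

lemma sum_len_le:
  assumes "finite F" "F \<subseteq> visits \<alpha> (H s) (H s')" "s \<le> s'"
  shows "sum len F \<le> s' - s"
proof -
  have "\<forall>i\<in>F. \<exists>m::int. H s < of_int i * \<alpha> + of_int m \<and> of_int i * \<alpha> + of_int m < H s'"
    using assms(2) unfolding visits_def by auto
  then obtain m :: "int \<Rightarrow> int" where m: "\<And>i. i \<in> F \<Longrightarrow> H s < of_int i * \<alpha> + of_int (m i)"
    "\<And>i. i \<in> F \<Longrightarrow> of_int i * \<alpha> + of_int (m i) < H s'"
    by metis
  define K where "K i = {b i + of_int (m i)<..<b i + of_int (m i) + len i}" for i
  have H_K: "H x = of_int i * \<alpha> + of_int (m i)" if "x \<in> K i" for x i
    using H_gap[of i "x - of_int (m i)"] H_shift_int[of "x - of_int (m i)" "m i"] that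
    unfolding K_def by simp
  have disj: "disjoint_family_on K F"
    unfolding disjoint_family_on_def
  proof (intro ballI impI equals0I)
    fix i j x assume "i \<noteq> j" "x \<in> K i \<inter> K j"
    then show False
      using H_K[of x i] H_K[of x j] irrational_multiple_inj[OF \<alpha>(3), of i "m i" j "m j"] by simp
  qed
  have sub: "(\<Union>i\<in>F. K i) \<subseteq> {s..s'}"
  proof
    fix x assume "x \<in> (\<Union>i\<in>F. K i)"
    then have "H s < H x" "H x < H s'"
      using m H_K by auto
    then have "\<not> x \<le> s" "\<not> s' \<le> x"
      using monoD[OF H_mono, of x s] monoD[OF H_mono, of s' x] by auto
    then show "x \<in> {s..s'}"
      by simp
  qed
  have "K ` F \<subseteq> sets lborel"
    unfolding K_def by auto
  have "ennreal (sum len F) = (\<Sum>i\<in>F. emeasure lborel (K i))"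
    using len_pos unfolding K_def by (simp add: less_imp_le)
  also have "\<dots> = emeasure lborel (\<Union>i\<in>F. K i)"
    using disj assms(1) \<open>K ` F \<subseteq> sets lborel\<close> by (intro sum_emeasure)
  also have "\<dots> \<le> emeasure lborel {s..s'}"
    using sub by (intro emeasure_mono) auto
  also have "\<dots> = ennreal (s' - s)"
    using assms(3) by simp
  finally show ?thesis
    using assms(3) by simp
qed

text \<open>The local step of the mass distribution argument: an interval of length \<open>t = v - u\<close> carries mass
  \<open>t\<close> with \<open>c t \<le> d\<^sup>\<beta>\<close>. Here \<open>d\<close> stands for the diameter of the covering set and \<open>S n\<close> for the lower bound on it at the
  scale \<open>n\<close> of the interval.\<close>

lemma mass_le_diameter:
  fixes S :: "nat \<Rightarrow> real"
  assumes \<beta>: "0 < \<beta>" and c: "0 \<le> c"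
    and t: "u \<le> v" "v - u < gauss_prod \<alpha> n0"
    and d: "0 \<le> d" "\<And>F. finite F \<Longrightarrow> F \<subseteq> visits \<alpha> u v \<Longrightarrow> sum len F \<le> d"
    and S: "\<And>n. n > n0 \<Longrightarrow> 0 \<le> S n \<and> c \<le> cf_denom \<alpha> n * S n powr \<beta>"
    and lower: "\<And>n d. n > n0 \<Longrightarrow> gauss_prod \<alpha> n < v - u \<Longrightarrow> v - u \<le> 1 / cf_denom \<alpha> n \<Longrightarrow>
      (\<forall>F. finite F \<and> F \<subseteq> visits \<alpha> u v \<longrightarrow> sum len F \<le> d) \<Longrightarrow> S n \<le> d"
  shows "c * (v - u) \<le> d powr \<beta>"
proof (cases "u = v")
  case True
  then show ?thesis by simp
next
  case False
  then have pos: "0 < v - u"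
    using t by simp
  have "\<exists>n. gauss_prod \<alpha> n < v - u"
    using order_tendstoD(2)[OF gauss_prod_tendsto_0[OF \<alpha>] pos]
    by (auto simp: eventually_sequentially)
  define n where "n = (LEAST n. gauss_prod \<alpha> n < v - u)"
  have n: "gauss_prod \<alpha> n < v - u"
    unfolding n_def by (rule LeastI_ex) fact
  have "n0 < n"
  proof (rule ccontr)
    assume "\<not> n0 < n"
    then have "gauss_prod \<alpha> n0 \<le> gauss_prod \<alpha> n"
      using decseqD[OF decseq_SucI[of "gauss_prod \<alpha>", OF gauss_prod_bounds(2)[OF \<alpha>]], of n n0] by simp
    then show False
      using n t by simp
  qed
  then obtain k where k: "n = Suc k"
    by (cases n) auto
  have "\<not> gauss_prod \<alpha> k < v - u"
    using not_less_Least[of k "\<lambda>n. gauss_prod \<alpha> n < v - u"] k unfolding n_def by simp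
  then have short: "v - u \<le> 1 / cf_denom \<alpha> n"
    using gauss_prod_le[OF \<alpha>, of k] k by simp
  have "S n \<le> d"
    using d by (intro lower \<open>n0 < n\<close> n short) auto
  then have "S n powr \<beta> \<le> d powr \<beta>"
    using S[OF \<open>n0 < n\<close>] \<beta> by (intro powr_mono2) auto
  moreover have "c * (v - u) \<le> S n powr \<beta>"
  proof -
    have "c * (v - u) \<le> c * (1 / cf_denom \<alpha> n)"
      using c short by (intro mult_left_mono) auto
    also have "\<dots> \<le> S n powr \<beta>"
      using S[OF \<open>n0 < n\<close>] cf_denom_pos[OF \<alpha>, of n] by (simp add: field_simps)
    finally show ?thesis .
  qed
  ultimately show ?thesis
    by simp
qed

text \<open>The global step: the images of the covering sets, folded into the unit interval, cover what is left of it
  outside of the exceptional set \<open>E\<close>.\<close>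

lemma cover_sum_ge:
  fixes S :: "nat \<Rightarrow> real" and E :: "real set" and U :: "nat \<Rightarrow> circle set"
  assumes \<beta>: "0 < \<beta>" and c: "0 \<le> c"
    and E: "E \<in> sets lborel"
    and r: "r \<le> 1 / 4" "\<And>x y. x \<le> y \<Longrightarrow> y - x < r \<Longrightarrow> H y - H x < gauss_prod \<alpha> n0"
    and U: "\<And>k. bounded (U k)" "\<And>k. diameter (U k) < r" "\<Omega> \<subseteq> (\<Union>k. U k)"
    and S: "\<And>n. n > n0 \<Longrightarrow> 0 \<le> S n \<and> c \<le> cf_denom \<alpha> n * S n powr \<beta>"
    and lower: "\<And>n u v d. n > n0 \<Longrightarrow> gauss_prod \<alpha> n < v - u \<Longrightarrow> v - u \<le> 1 / cf_denom \<alpha> n \<Longrightarrow>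
      \<not> fold_mod_one u v \<subseteq> E \<Longrightarrow>
      (\<forall>F. finite F \<and> F \<subseteq> visits \<alpha> u v \<longrightarrow> sum len F \<le> d) \<Longrightarrow> S n \<le> d"
  shows "ennreal c \<le> ennreal c * emeasure lborel E + (\<Sum>k. ennreal (diameter (U k) powr \<beta>))"
proof -
  have "\<forall>k. \<exists>s s'. s \<le> s' \<and> s' - s \<le> diameter (U k) \<and> U k \<subseteq> circle_of ` {s..s'}"
  proof
    fix k
    have "diameter (U k) < 1 / 4"
      using U(2)[of k] r(1) by simp
    then show "\<exists>s s'. s \<le> s' \<and> s' - s \<le> diameter (U k) \<and> U k \<subseteq> circle_of ` {s..s'}"
      using lift_small_set[OF U(1)] by metis
  qed
  then obtain s s' where s: "\<And>k. s k \<le> s' k" "\<And>k. s' k - s k \<le> diameter (U k)"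
    "\<And>k. U k \<subseteq> circle_of ` {s k..s' k}"
    by metis
  define T where "T k = (if fold_mod_one (H (s k)) (H (s' k)) \<subseteq> E then {}
    else fold_mod_one (H (s k)) (H (s' k)))" for k
  have T_sets: "T k \<in> sets lborel" for k
    using sets_fold_mod_one unfolding T_def by simp
  have "{0..<1} \<subseteq> E \<union> (\<Union>k. T k)"
  proof
    fix y :: real assume y: "y \<in> {0..<1}"
    obtain x where x: "H x = y" "circle_of x \<in> \<Omega>"
      using \<Omega>_onto by blast
    then obtain k z where z: "z \<in> {s k..s' k}" "circle_of x = circle_of z"
      using U(3) s(3) by blast
    then obtain m :: int where "x = z + of_int m"
      unfolding circle_of_eq_iff by (metis Ints_cases add.commute diff_add_cancel)
    then have "H z = y - of_int m"
      using H_shift_int[of z m] x by simp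
    then have "H (s k) - of_int (- m) \<le> y" "y \<le> H (s' k) - of_int (- m)"
      using monoD[OF H_mono, of "s k" z] monoD[OF H_mono, of z "s' k"] z by auto
    then have "y \<in> fold_mod_one (H (s k)) (H (s' k))"
      using y unfolding fold_mod_one_def by (intro IntI UN_I[of "- m"]) auto
    then show "y \<in> E \<union> (\<Union>k. T k)"
      unfolding T_def by (cases "fold_mod_one (H (s k)) (H (s' k)) \<subseteq> E") auto
  qed
  then have "emeasure lborel {0..<1::real} \<le> emeasure lborel (E \<union> (\<Union>k. T k))"
    using E T_sets by (intro emeasure_mono) auto
  also have "\<dots> \<le> emeasure lborel E + emeasure lborel (\<Union>k. T k)"
    using E T_sets by (intro emeasure_subadditive) auto
  also have "\<dots> \<le> emeasure lborel E + (\<Sum>k. emeasure lborel (T k))"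
    using T_sets by (intro add_left_mono emeasure_subadditive_countably) auto
  finally have "ennreal c * 1 \<le> ennreal c * (emeasure lborel E + (\<Sum>k. emeasure lborel (T k)))"
    by (intro mult_left_mono) auto
  also have "\<dots> = ennreal c * emeasure lborel E + (\<Sum>k. ennreal c * emeasure lborel (T k))"
    by (simp add: distrib_left)
  also have "\<dots> \<le> ennreal c * emeasure lborel E + (\<Sum>k. ennreal (diameter (U k) powr \<beta>))"
  proof (intro add_left_mono suminf_le allI)
    fix k
    show "ennreal c * emeasure lborel (T k) \<le> ennreal (diameter (U k) powr \<beta>)"
    proof (cases "fold_mod_one (H (s k)) (H (s' k)) \<subseteq> E")
      case True
      then show ?thesis by (simp add: T_def)
    next
      case False
      have mono: "H (s k) \<le> H (s' k)"
        using monoD[OF H_mono s(1)] .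
      have "c * (H (s' k) - H (s k)) \<le> diameter (U k) powr \<beta>"
      proof (rule mass_le_diameter[where ?n0.0 = n0 and S = S])
        show "H (s' k) - H (s k) < gauss_prod \<alpha> n0"
          using s(1)[of k] s(2)[of k] U(2)[of k] by (intro r(2)) auto
        show "sum len F \<le> diameter (U k)" if "finite F" "F \<subseteq> visits \<alpha> (H (s k)) (H (s' k))" for F
          using sum_len_le[OF that s(1)] s(2)[of k] by simp
      qed (use \<beta> c mono S False lower diameter_ge_0[OF U(1)] in auto)
      then have "ennreal (c * (H (s' k) - H (s k))) \<le> ennreal (diameter (U k) powr \<beta>)"
        by (rule ennreal_leI)
      moreover have "ennreal c * emeasure lborel (T k) \<le> ennreal c * ennreal (H (s' k) - H (s k))"
        using False emeasure_fold_mod_one_le[OF mono] unfolding T_def by (auto intro: mult_left_mono)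
      ultimately show ?thesis
        using c mono by (simp add: ennreal_mult')
    qed
  qed auto
  finally show ?thesis
    by simp
qed

text \<open>The mass distribution principle. The bound \<open>S n\<close> may fail for intervals that lie entirely in \<open>E n\<close>. Because
  \<open>1 / q\<^sub>n\<close> is summable, the sets \<open>E n\<close> with large \<open>n\<close> cover only a negligible part of the mass, and covers by
  small sets involve large \<open>n\<close> only.\<close>

lemma hausdorff_measure_ge:
  fixes S :: "nat \<Rightarrow> real" and E :: "nat \<Rightarrow> real set"
  assumes \<beta>: "0 < \<beta>" and c: "0 \<le> c" and C: "0 \<le> C"
    and E: "\<And>n. E n \<in> sets lborel"
      "\<And>n. n \<ge> n1 \<Longrightarrow> emeasure lborel (E n) \<le> ennreal (C / cf_denom \<alpha> n)"
    and S: "\<And>n. n \<ge> n1 \<Longrightarrow> 0 \<le> S n \<and> c \<le> cf_denom \<alpha> n * S n powr \<beta>"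
    and lower: "\<And>n u v d. n \<ge> n1 \<Longrightarrow> gauss_prod \<alpha> n < v - u \<Longrightarrow> v - u \<le> 1 / cf_denom \<alpha> n \<Longrightarrow>
      \<not> fold_mod_one u v \<subseteq> E n \<Longrightarrow>
      (\<forall>F. finite F \<and> F \<subseteq> visits \<alpha> u v \<longrightarrow> sum len F \<le> d) \<Longrightarrow> S n \<le> d"
  shows "ennreal c \<le> hausdorff_measure \<beta> \<Omega>"
proof (rule ennreal_le_epsilon)
  fix e :: real assume "0 < e"
  define x where "x n = C / cf_denom \<alpha> n" for n
  have summ: "summable x"
    using summable_mult[OF summable_inverse_cf_denom[OF \<alpha>], of C] unfolding x_def by simp
  \<comment> \<open>\<open>c + 1\<close> instead of \<open>c\<close> covers the case \<open>c = 0\<close>\<close>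
  have "0 < e / (c + 1)"
    using \<open>0 < e\<close> c by simp
  then obtain N where N: "\<And>n. n \<ge> N \<Longrightarrow> norm (\<Sum>i. x (i + n)) < e / (c + 1)"
    using suminf_exist_split[OF _ summ] by blast
  define n0 where "n0 = max N n1"
  define E' where "E' = (\<Union>i. E (i + Suc n0))"
  have E': "E' \<in> sets lborel"
    unfolding E'_def using E(1) by blast
  have "emeasure lborel E' \<le> (\<Sum>i. emeasure lborel (E (i + Suc n0)))"
    unfolding E'_def using E(1) by (intro emeasure_subadditive_countably) auto
  also have "\<dots> \<le> (\<Sum>i. ennreal (x (i + Suc n0)))"
    unfolding x_def by (intro suminf_le E(2)) (auto simp: n0_def)
  also have "\<dots> = ennreal (\<Sum>i. x (i + Suc n0))"
    using C by (intro suminf_ennreal2 summable_ignore_initial_segment summ) (simp add: x_def)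
  also have "\<dots> \<le> ennreal (e / (c + 1))"
  proof (rule ennreal_leI)
    have "N \<le> Suc n0"
      by (simp add: n0_def)
    from N[OF this] show "(\<Sum>i. x (i + Suc n0)) \<le> e / (c + 1)"
      by simp
  qed
  finally have "ennreal c * emeasure lborel E' \<le> ennreal c * ennreal (e / (c + 1))"
    by (intro mult_left_mono) auto
  also have "\<dots> = ennreal (c * (e / (c + 1)))"
    using c \<open>0 < e\<close> by (intro ennreal_mult[symmetric]) auto
  also have "\<dots> \<le> ennreal e"
    using c \<open>0 < e\<close> by (intro ennreal_leI) (simp add: field_simps)
  finally have cE': "ennreal c * emeasure lborel E' \<le> ennreal e" .
  obtain r where r: "0 < r" "\<And>x y. x \<le> y \<Longrightarrow> y - x < r \<Longrightarrow> H y - H x < gauss_prod \<alpha> n0"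
    using uniformly_continuous_collapse[OF gauss_prod_bounds(1)[OF \<alpha>]] by metis
  define r' where "r' = min r (1 / 4)"
  have "ennreal c - ennreal e \<le> hausdorff_content \<beta> r' \<Omega>"
    unfolding hausdorff_content_def
  proof (rule INF_greatest)
    fix U :: "nat \<Rightarrow> circle set"
    assume "U \<in> {U. (\<forall>k. bounded (U k) \<and> diameter (U k) < r') \<and> \<Omega> \<subseteq> (\<Union>k. U k)}"
    then have U: "\<And>k. bounded (U k)" "\<And>k. diameter (U k) < r'" "\<Omega> \<subseteq> (\<Union>k. U k)"
      by auto
    have "ennreal c \<le> ennreal c * emeasure lborel E' + (\<Sum>k. ennreal (diameter (U k) powr \<beta>))"
    proof (rule cover_sum_ge[OF \<beta> c E' _ _ U, where ?n0.0 = n0 and S = S])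
      show "0 \<le> S n \<and> c \<le> cf_denom \<alpha> n * S n powr \<beta>" if "n0 < n" for n
        using that by (intro S) (auto simp: n0_def)
      fix n u v d
      assume n: "n0 < n" "gauss_prod \<alpha> n < v - u" "v - u \<le> 1 / cf_denom \<alpha> n"
        and "\<not> fold_mod_one u v \<subseteq> E'"
        and d: "\<forall>F. finite F \<and> F \<subseteq> visits \<alpha> u v \<longrightarrow> sum len F \<le> d"
      moreover have "E n \<subseteq> E'"
        using n(1) unfolding E'_def by (intro subset_trans[OF _ UN_upper[of "n - Suc n0"]]) auto
      ultimately show "S n \<le> d"
        by (intro lower[OF _ n(2,3) _ d]) (auto simp: n0_def)
    qed (use r in \<open>auto simp: r'_def\<close>)
    also have "\<dots> \<le> ennreal e + (\<Sum>k. ennreal (diameter (U k) powr \<beta>))"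
      using cE' by (rule add_right_mono)
    finally show "ennreal c - ennreal e \<le> (\<Sum>k. ennreal (diameter (U k) powr \<beta>))"
      by (simp add: ennreal_minus_le_iff)
  qed
  also have "\<dots> \<le> hausdorff_measure \<beta> \<Omega>"
    using r(1) by (intro hausdorff_content_le_measure) (simp add: r'_def)
  finally show "ennreal c \<le> hausdorff_measure \<beta> \<Omega> + ennreal e"
    by (simp add: ennreal_minus_le_iff add.commute)
qed

end

section \<open>The Denjoy map as a collapse of gaps\<close>

text \<open>On the arc \<open>H\<close> differs from \<open>y\<close> by an integer, which is constant by continuity.\<close>

lemma collapsed_gap_lift:
  assumes H: "is_lift H h" and l: "0 < l"
    and coll: "\<And>p. p \<in> open_arc a l \<Longrightarrow> h p = circle_of y"
  shows "\<exists>m::int. \<forall>x\<in>{a..a + l}. H x = y + of_int m"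
proof -
  have cont: "continuous_on A H" for A
    using H continuous_on_subset unfolding is_lift_def by blast
  have int: "H x - y \<in> \<int>" if "x \<in> {a<..<a + l}" for x
  proof -
    have "circle_of (H x) = circle_of y"
      using H coll[of "circle_of x"] that unfolding is_lift_def open_arc_def by auto
    then show ?thesis
      by (simp add: circle_of_eq_iff)
  qed
  have "H constant_on {a<..<a + l}"
  proof (rule continuous_discrete_range_constant)
    show "\<exists>e>0. \<forall>z. z \<in> {a<..<a + l} \<and> H z \<noteq> H x \<longrightarrow> e \<le> norm (H z - H x)"
      if "x \<in> {a<..<a + l}" for x
    proof (intro exI[of _ 1] conjI allI impI)
      fix z assume z: "z \<in> {a<..<a + l} \<and> H z \<noteq> H x"
      then have "(H z - y) - (H x - y) \<in> \<int>"
        using Ints_diff[OF int[of z] int[OF that]] z by blast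
      then show "1 \<le> norm (H z - H x)"
        using z Ints_nonzero_abs_ge1[of "H z - H x"] by simp
    qed simp
  qed (use cont in auto)
  then obtain c where c: "\<And>x. x \<in> {a<..<a + l} \<Longrightarrow> H x = c"
    unfolding constant_on_def by blast
  have "c - y \<in> \<int>"
    using int[of "a + l / 2"] c[of "a + l / 2"] l by simp
  then obtain m :: int where m: "c = y + of_int m"
    by (metis Ints_cases add.commute diff_add_cancel)
  have "H x = c" if "x \<in> closure {a<..<a + l}" for x
    using continuous_constant_on_closure[OF cont c that] by simp
  then show ?thesis
    using l m by (intro exI[of _ m]) auto
qed

text \<open>Translating the lift of \<open>J n\<close> by the integer of \<open>collapsed_gap_lift\<close> gives \<open>b n\<close>. Every
  value of \<open>H\<close> is attained on the minimal set:
  a value attained inside a gap is also attained at the left endpoint of that gap, which belongs to no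
  gap.\<close>

lemma denjoy_map_collapsed_gaps:
  assumes \<alpha>: "0 < \<alpha>" "\<alpha> < 1" "\<alpha> \<notin> \<rat>"
    and len: "\<And>n. 0 < len n"
    and f: "denjoy_map \<delta> \<alpha> len J f"
  obtains b H where "collapsed_gaps \<alpha> len b H (denjoy_minimal_set J)"
proof -
  obtain a where a: "\<And>n. J n = open_arc (a n) (len n)"
    using f unfolding denjoy_map_def by metis
  obtain h H where H: "is_lift H h" "mono H"
    and fibre: "\<And>n. h -` {circle_of (of_int n * \<alpha>)} = closure (J n)"
    using f unfolding denjoy_map_def denjoy_semiconjugacy_def by metis
  have "\<exists>m::int. \<forall>x\<in>{a n..a n + len n}. H x = of_int n * \<alpha> + of_int m" for n
  proof (rule collapsed_gap_lift[OF H(1) len])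
    fix p assume "p \<in> open_arc (a n) (len n)"
    then show "h p = circle_of (of_int n * \<alpha>)"
      using a closure_subset[of "J n"] fibre[of n] by auto
  qed
  then obtain m :: "int \<Rightarrow> int"
    where m: "\<And>n x. x \<in> {a n..a n + len n} \<Longrightarrow> H x = of_int n * \<alpha> + of_int (m n)"
    by metis
  define b where "b n = a n - of_int (m n)" for n
  have cont: "continuous_on UNIV H" and shift: "H (x + 1) = H x + 1" for x
    using H unfolding is_lift_def by auto
  note shift_int = degree_one_shift_int[of H, OF shift]
  have gap: "H x = of_int n * \<alpha>" if "b n \<le> x" "x \<le> b n + len n" for n x
    using m[of "x + of_int (m n)" n] shift_int[of x "m n"] that unfolding b_def by simp
  have arc: "\<exists>k::int. b n < x + of_int k \<and> x + of_int k < b n + len n" if x: "circle_of x \<in> J n" for x n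
  proof -
    obtain z where z: "z \<in> {a n<..<a n + len n}" "circle_of x = circle_of z"
      using x unfolding a open_arc_def by blast
    then obtain k :: int where "z = x + of_int k"
      unfolding circle_of_eq_iff by (metis Ints_cases Ints_minus minus_diff_eq add.commute diff_add_cancel)
    then show ?thesis
      using z unfolding b_def by (intro exI[of _ "k - m n"]) auto
  qed
  have onto: "\<exists>x. H x = y \<and> circle_of x \<in> denjoy_minimal_set J" for y
  proof -
    have "H (of_int (\<lfloor>y - H 0\<rfloor>)) \<le> y" "y \<le> H (of_int (\<lfloor>y - H 0\<rfloor> + 1))"
      using shift_int[of 0 "\<lfloor>y - H 0\<rfloor>"] shift_int[of 0 "\<lfloor>y - H 0\<rfloor> + 1"] by simp_all linarith+
    then obtain x where x: "H x = y"
      using IVT'[of H "of_int (\<lfloor>y - H 0\<rfloor>)" y "of_int (\<lfloor>y - H 0\<rfloor> + 1)"]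
        continuous_on_subset[OF cont] by auto
    show ?thesis
    proof (cases "circle_of x \<in> denjoy_minimal_set J")
      case False
      then obtain n where "circle_of x \<in> J n"
        unfolding denjoy_minimal_set_def by blast
      then obtain k :: int where k: "b n < x + of_int k" "x + of_int k < b n + len n"
        using arc by blast
      then have y: "y = of_int n * \<alpha> - of_int k"
        using gap[of n "x + of_int k"] shift_int[of x k] x by simp
      have "circle_of (b n - of_int k) \<notin> J i" for i
      proof
        assume "circle_of (b n - of_int k) \<in> J i"
        then obtain j :: int where j: "b i < b n - of_int k + of_int j" "b n - of_int k + of_int j < b i + len i"
          using arc by blast
        have "H (b n + of_int (j - k)) = of_int i * \<alpha>"
          using j by (intro gap) auto
        then have eq: "of_int n * \<alpha> + of_int (j - k) = of_int i * \<alpha> + of_int 0"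
          using shift_int[of "b n" "j - k"] gap[of n "b n"] less_imp_le[OF len[of n]] by simp
        then have "n = i"
          by (rule irrational_multiple_inj[OF \<alpha>(3)])
        then show False
          using eq j by simp
      qed
      moreover have "H (b n - of_int k) = y"
        using shift_int[of "b n - of_int k" k] gap[of n "b n"] less_imp_le[OF len[of n]] y by simp
      ultimately show ?thesis
        unfolding denjoy_minimal_set_def by blast
    qed (use x in blast)
  qed
  show thesis
    by (rule that[of b H], unfold_locales) (use \<alpha> len cont H(2) shift gap onto in auto)
qed

section \<open>Sums of minima over windows of indices\<close>

text \<open>Visits in disjoint windows are distinct, so the bounds \<open>g l\<close> are dominated by distinct gaps.\<close>

lemma sum_over_windows_le:
  fixes len g :: "int \<Rightarrow> real" and p R :: int
  assumes "finite F"
    and hit: "\<And>l. l \<in> F \<Longrightarrow> \<exists>i\<in>A. p + l * R \<le> i \<and> i < p + (l + 1) * R \<and> g l \<le> len i"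
    and d: "\<forall>G. finite G \<and> G \<subseteq> A \<longrightarrow> sum len G \<le> d"
  shows "sum g F \<le> d"
proof -
  obtain i where i: "\<And>l. l \<in> F \<Longrightarrow> i l \<in> A" "\<And>l. l \<in> F \<Longrightarrow> p + l * R \<le> i l"
    "\<And>l. l \<in> F \<Longrightarrow> i l < p + (l + 1) * R" "\<And>l. l \<in> F \<Longrightarrow> g l \<le> len (i l)"
    using hit by metis
  have "inj_on i F"
  proof (rule inj_onI)
    fix l l' assume l: "l \<in> F" "l' \<in> F" "i l = i l'"
    have "l * R < (l + 1) * R" "l * R < (l' + 1) * R" "l' * R < (l + 1) * R"
      using i(2,3)[OF l(1)] i(2,3)[OF l(2)] l(3) by linarith+
    moreover from this(1) have "0 < R"
      by (simp add: algebra_simps)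
    ultimately have "l < l' + 1" "l' < l + 1"
      using mult_less_cancel_right_pos by blast+
    then show "l = l'"
      by simp
  qed
  have "sum g F \<le> (\<Sum>l\<in>F. len (i l))"
    using i(4) by (rule sum_mono)
  also have "\<dots> = sum len (i ` F)"
    using \<open>inj_on i F\<close> by (simp add: sum.reindex)
  also have "\<dots> \<le> d"
    using d i(1) assms(1) by blast
  finally show ?thesis .
qed

lemma Min_window_le:
  fixes len :: "int \<Rightarrow> real"
  assumes "finite {i. P i}" "P j"
  shows "Min {len i | i. P i} \<le> len j"
  using assms by (intro Min_le) auto

lemma Min_window_nonneg:
  fixes len :: "int \<Rightarrow> real"
  assumes "finite {i. P i}" "P j" "\<And>i. 0 < len i"
  shows "0 \<le> Min {len i | i. P i}"
proof -
  have "Min {len i | i. P i} \<in> {len i | i. P i}"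
    using assms by (intro Min_in) auto
  then obtain i where "Min {len i | i. P i} = len i"
    by blast
  then show ?thesis
    using less_imp_le[OF assms(3)] by simp
qed

lemma infsum_approx_from_below:
  fixes g :: "'i \<Rightarrow> real"
  assumes "z < infsum g UNIV" "0 < infsum g UNIV"
  obtains F where "finite F" "z < sum g F"
proof -
  have "g summable_on UNIV"
    using assms(2) infsum_not_exists[of g UNIV] by fastforce
  then have "\<not> (\<forall>F. finite F \<longrightarrow> sum g F \<le> z)"
    using infsum_le_finite_sums[of g UNIV z] assms(1) by fastforce
  then show thesis
    using that by (auto simp: not_le)
qed

text \<open>A closed window \<open>{x..x + 2 N\<^sub>n}\<close> has at least \<open>q\<^sub>n + q\<^sub>n\<^sub>+\<^sub>1\<close> elements, so it contains a visit
  to every interval longer than \<open>gauss_prod \<alpha> n\<close>. The half-open window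
  may be one element short.\<close>

lemma cf_N_bounds: "cf_Q \<alpha> n \<le> 2 * cf_N \<alpha> n + 1"
proof -
  have "real (cf_denom \<alpha> n + cf_denom \<alpha> (n + 1)) / 2 < of_int (cf_N \<alpha> n) + 1"
    unfolding cf_N_def by linarith
  then have "real_of_int (cf_Q \<alpha> n) < of_int (2 * cf_N \<alpha> n + 2)"
    unfolding cf_Q_def by simp
  then show ?thesis
    unfolding of_int_less_iff by simp
qed

lemma cf_N_nonneg: "0 \<le> cf_N \<alpha> n"
  unfolding cf_N_def by simp

section \<open>Lower bounds for the Hausdorff measure\<close>

context collapsed_gaps
begin

lemma central_window_bound:
  assumes "0 < \<beta>"
  shows "liminf (\<lambda>n. ennreal (real (cf_denom \<alpha> n) *
      (Min {len i | i. - cf_N \<alpha> n \<le> i \<and> i \<le> cf_N \<alpha> n}) powr \<beta>)) \<le> hausdorff_measure \<beta> \<Omega>"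
proof (rule le_of_liminf)
  fix c n1
  define S where "S n = Min {len i | i. - cf_N \<alpha> n \<le> i \<and> i \<le> cf_N \<alpha> n}" for n
  assume "0 < c" and "\<And>n. n \<ge> n1 \<Longrightarrow> c < real (cf_denom \<alpha> n) *
      (Min {len i | i. - cf_N \<alpha> n \<le> i \<and> i \<le> cf_N \<alpha> n}) powr \<beta>"
  then have c: "\<And>n. n \<ge> n1 \<Longrightarrow> c < cf_denom \<alpha> n * S n powr \<beta>"
    unfolding S_def by blast
  have fin: "finite {i. - cf_N \<alpha> n \<le> i \<and> i \<le> cf_N \<alpha> n}" for n
    by (rule finite_subset[OF _ finite_atLeastAtMost_int[of "- cf_N \<alpha> n" "cf_N \<alpha> n"]]) auto
  show "ennreal c \<le> hausdorff_measure \<beta> \<Omega>"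
  proof (rule hausdorff_measure_ge[where S = S and E = "\<lambda>_. {}" and C = 0 and ?n1.0 = n1])
    show "0 \<le> S n \<and> c \<le> cf_denom \<alpha> n * S n powr \<beta>" if "n1 \<le> n" for n
      using c[OF that] Min_window_nonneg[OF fin, of n 0] cf_N_nonneg[of \<alpha> n] len_pos
      unfolding S_def by auto
    fix n u v d
    assume long: "gauss_prod \<alpha> n < v - u"
      and d: "\<forall>F. finite F \<and> F \<subseteq> visits \<alpha> u v \<longrightarrow> sum len F \<le> d"
    obtain i where i: "i \<in> visits \<alpha> u v" "- cf_N \<alpha> n \<le> i" "i < - cf_N \<alpha> n + cf_Q \<alpha> n"
      using consecutive_visit[OF \<alpha> long, of "- cf_N \<alpha> n"] by blast
    have "S n \<le> len i"
      using i cf_N_bounds[of \<alpha> n] unfolding S_def by (intro Min_window_le fin) auto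
    also have "\<dots> \<le> d"
      using d[rule_format, of "{i}"] i(1) by simp
    finally show "S n \<le> d" .
  qed (use assms \<open>0 < c\<close> in auto)
qed

text \<open>The sums over all sequences \<open>P\<close> share an upper bound, since a long interval visits every window; it
  makes the supremum a genuine one, so that it is nonnegative.\<close>

lemma disjoint_windows_bound:
  assumes "0 < \<beta>"
  shows "liminf (\<lambda>n. ennreal (real (cf_denom \<alpha> n) *
      (SUP P \<in> {P :: int \<Rightarrow> int. \<forall>l. P l - P (l - 1) = cf_Q \<alpha> n}.
        \<Sum>\<^sub>\<infinity>l::int. Min {len i | i. P (l - 1) \<le> i \<and> i < P l}) powr \<beta>)) \<le> hausdorff_measure \<beta> \<Omega>"
proof (rule le_of_liminf)
  fix c n1
  define Ps where "Ps n = {P :: int \<Rightarrow> int. \<forall>l. P l - P (l - 1) = cf_Q \<alpha> n}" for n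
  define M where "M P = (\<Sum>\<^sub>\<infinity>l::int. Min {len i | i. P (l - 1) \<le> i \<and> i < P l})" for P :: "int \<Rightarrow> int"
  define S where "S n = Sup (M ` Ps n)" for n
  assume "0 < c" and "\<And>n. n \<ge> n1 \<Longrightarrow> c < real (cf_denom \<alpha> n) *
      (SUP P \<in> {P :: int \<Rightarrow> int. \<forall>l. P l - P (l - 1) = cf_Q \<alpha> n}.
        \<Sum>\<^sub>\<infinity>l::int. Min {len i | i. P (l - 1) \<le> i \<and> i < P l}) powr \<beta>"
  then have c: "\<And>n. n \<ge> n1 \<Longrightarrow> c < cf_denom \<alpha> n * S n powr \<beta>"
    unfolding S_def M_def Ps_def by blast
  have ne: "Ps n \<noteq> {}" for n
    unfolding Ps_def by (auto intro!: exI[of _ "\<lambda>l. l * cf_Q \<alpha> n"] simp: algebra_simps)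
  have fin: "finite {i. P (l - 1) \<le> i \<and> i < P l}" for P :: "int \<Rightarrow> int" and l
    by (rule finite_subset[OF _ finite_atLeastAtMost_int[of "P (l - 1)" "P l"]]) auto
  have Q: "0 < cf_Q \<alpha> n" for n
    using cf_denom_pos[OF \<alpha>, of n] by (simp add: cf_Q_def)
  have P: "P l = P 0 + l * cf_Q \<alpha> n" if "P \<in> Ps n" for P l n
  proof (induction l rule: int_induct[where k = 0])
    case (step1 l)
    have "P (l + 1) - P (l + 1 - 1) = cf_Q \<alpha> n"
      using that unfolding Ps_def by blast
    with step1 show ?case by (simp add: algebra_simps)
  next
    case (step2 l)
    have "P l - P (l - 1) = cf_Q \<alpha> n"
      using that unfolding Ps_def by blast
    with step2 show ?case by (simp add: algebra_simps)
  qed simp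
  have upper: "M P \<le> d"
    if P_in: "P \<in> Ps n" and long: "gauss_prod \<alpha> n < v - u"
      and d: "\<forall>F. finite F \<and> F \<subseteq> visits \<alpha> u v \<longrightarrow> sum len F \<le> d" for n u v d P
  proof -
    let ?m = "\<lambda>l. Min {len i | i. P (l - 1) \<le> i \<and> i < P l}"
    have part: "sum ?m F \<le> d" if "finite F" for F
    proof (rule sum_over_windows_le[OF that _ d, where p = "P (-1)" and R = "cf_Q \<alpha> n"])
      fix l
      obtain i where i: "i \<in> visits \<alpha> u v" "P (l - 1) \<le> i" "i < P (l - 1) + cf_Q \<alpha> n"
        using consecutive_visit[OF \<alpha> long, of "P (l - 1)"] by blast
      have "P (l - 1) + cf_Q \<alpha> n = P l"
        using P[OF P_in, of "l - 1"] P[OF P_in, of l] by (simp add: algebra_simps)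
      with i(2,3) have "?m l \<le> len i"
        by (intro Min_window_le fin) auto
      moreover have "P (-1) + l * cf_Q \<alpha> n = P (l - 1)"
        using P[OF P_in, of "l - 1"] P[OF P_in, of "-1"] by (simp add: algebra_simps)
      ultimately show "\<exists>i\<in>visits \<alpha> u v. P (-1) + l * cf_Q \<alpha> n \<le> i \<and> i < P (-1) + (l + 1) * cf_Q \<alpha> n \<and> ?m l \<le> len i"
        using i by (intro bexI[of _ i]) (simp_all add: distrib_right)
    qed
    show ?thesis
    proof (cases "?m summable_on UNIV")
      case True
      then show ?thesis
        unfolding M_def using part by (intro infsum_le_finite_sums) auto
    next
      case False
      then show ?thesis
        unfolding M_def using d[rule_format, of "{}"] by (simp add: infsum_not_exists)
    qed
  qed
  have nonneg: "0 \<le> M P" if "P \<in> Ps n" for P n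
    unfolding M_def
  proof (rule infsum_nonneg)
    fix l
    show "0 \<le> Min {len i | i. P (l - 1) \<le> i \<and> i < P l}"
      using P[OF that, of "l - 1"] P[OF that, of l] Q[of n] len_pos
      by (intro Min_window_nonneg[OF fin, where j = "P (l - 1)"]) (auto simp: algebra_simps)
  qed
  have bdd: "bdd_above (M ` Ps n)" for n
  proof (rule bdd_aboveI2)
    fix P assume "P \<in> Ps n"
    moreover have "gauss_prod \<alpha> n < H 2 - H 0"
    proof -
      have "gauss_prod \<alpha> n \<le> 1 / real (cf_denom \<alpha> (Suc n))"
        by (rule gauss_prod_le[OF \<alpha>])
      also have "\<dots> \<le> 1"
        using cf_denom_pos[OF \<alpha>, of "Suc n"] by simp
      finally show ?thesis
        using H_shift_int[of 0 2] by simp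
    qed
    moreover have "\<forall>F. finite F \<and> F \<subseteq> visits \<alpha> (H 0) (H 2) \<longrightarrow> sum len F \<le> 2"
      using sum_len_le[of _ 0 2] by auto
    ultimately show "M P \<le> 2"
      by (rule upper)
  qed
  have S_nonneg: "0 \<le> S n" for n
  proof -
    obtain P where "P \<in> Ps n"
      using ne by blast
    then show ?thesis
      unfolding S_def using nonneg by (intro cSUP_upper2[OF bdd]) auto
  qed
  show "ennreal c \<le> hausdorff_measure \<beta> \<Omega>"
  proof (rule hausdorff_measure_ge[where S = S and E = "\<lambda>_. {}" and C = 0 and ?n1.0 = n1])
    show "0 \<le> S n \<and> c \<le> cf_denom \<alpha> n * S n powr \<beta>" if "n1 \<le> n" for n
      using c[OF that] S_nonneg by auto
    show "S n \<le> d" if "gauss_prod \<alpha> n < v - u"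
      "\<forall>F. finite F \<and> F \<subseteq> visits \<alpha> u v \<longrightarrow> sum len F \<le> d" for n u v d
      unfolding S_def using upper that by (intro cSUP_least ne) auto
  qed (use assms \<open>0 < c\<close> in auto)
qed

text \<open>A factor \<open>\<epsilon>\<close> is lost twice: once in passing from the infinite sum to a finite set \<open>F\<close> of windows, and once
  for the windows \<open>B\<close> whose right endpoint is visited. The remaining windows are visited in their half-open parts,
  which are disjoint.\<close>

lemma overlapping_windows_bound_up_to_factor:
  defines "m \<equiv> \<lambda>n l. Min {len i | i. (2 * l - 1) * cf_N \<alpha> n \<le> i \<and> i \<le> (2 * l + 1) * cf_N \<alpha> n}"
  assumes \<beta>: "0 < \<beta>" and \<epsilon>: "0 < \<epsilon>" "\<epsilon> < 1 / 2" and "0 < c"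
    and c: "\<And>n. n \<ge> n1 \<Longrightarrow> c < real (cf_denom \<alpha> n) * (\<Sum>\<^sub>\<infinity>l. m n l) powr \<beta>"
  shows "ennreal (c * (1 - 2 * \<epsilon>) powr \<beta>) \<le> hausdorff_measure \<beta> \<Omega>"
proof -
  define M where "M n = (\<Sum>\<^sub>\<infinity>l. m n l)" for n
  have N: "0 < cf_N \<alpha> n" for n
    using cf_N_bounds[of \<alpha> n] cf_denom_pos[OF \<alpha>, of n] cf_denom_pos[OF \<alpha>, of "n + 1"]
    unfolding cf_Q_def by linarith
  have fin: "finite {i. (2 * l - 1) * cf_N \<alpha> n \<le> i \<and> i \<le> (2 * l + 1) * cf_N \<alpha> n}" for l n
    by (rule finite_subset[OF _ finite_atLeastAtMost_int[of "(2 * l - 1) * cf_N \<alpha> n" "(2 * l + 1) * cf_N \<alpha> n"]]) auto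
  have m_nn: "0 \<le> m n l" for n l
    unfolding m_def using N[of n] len_pos
    by (intro Min_window_nonneg[OF fin, where j = "(2 * l - 1) * cf_N \<alpha> n"]) (auto simp: algebra_simps)
  have M_pos: "0 < M n" if "n \<ge> n1" for n
  proof -
    have "M n \<noteq> 0"
      using c[OF that] \<open>0 < c\<close> unfolding M_def by auto
    moreover have "0 \<le> M n"
      unfolding M_def using m_nn by (intro infsum_nonneg)
    ultimately show ?thesis by simp
  qed
  have "\<exists>F. n \<ge> n1 \<longrightarrow> finite F \<and> (1 - \<epsilon>) * M n < sum (m n) F" for n
  proof (cases "n \<ge> n1")
    case True
    then have "(1 - \<epsilon>) * M n < M n"
      using M_pos[OF True] \<epsilon> by simp
    then show ?thesis
      using infsum_approx_from_below[of "(1 - \<epsilon>) * M n" "m n"] M_pos[OF True] unfolding M_def by metis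
  qed blast
  then obtain F where F: "\<And>n. n \<ge> n1 \<Longrightarrow> finite (F n)" "\<And>n. n \<ge> n1 \<Longrightarrow> (1 - \<epsilon>) * M n < sum (m n) (F n)"
    by metis
  define e where "e n l = of_int ((2 * l + 1) * cf_N \<alpha> n) * \<alpha>" for n l
  define \<rho> where "\<rho> n = 1 / real (cf_denom \<alpha> n)" for n
  have \<rho>: "0 \<le> \<rho> n" for n
    unfolding \<rho>_def by simp
  define E where "E n = (if n \<ge> n1 then {y \<in> {0..<1}. \<epsilon> * M n \<le>
    (\<Sum>l\<in>F n. m n l * indicator (fold_mod_one (e n l - \<rho> n) (e n l + \<rho> n)) y)} else {})" for n
  show ?thesis
  proof (rule hausdorff_measure_ge[where S = "\<lambda>n. (1 - 2 * \<epsilon>) * M n" and E = E and C = "2 / \<epsilon>" and ?n1.0 = n1])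
    show "E n \<in> sets lborel" for n
      unfolding E_def using heavy_points(1)[OF F(1) m_nn _ \<rho>] M_pos \<epsilon> by auto
    show "emeasure lborel (E n) \<le> ennreal (2 / \<epsilon> / cf_denom \<alpha> n)" if n: "n \<ge> n1" for n
    proof -
      have "sum (m n) (F n) \<le> M n"
      proof -
        have "m n summable_on UNIV"
          using M_pos[OF n] infsum_not_exists[of "m n" UNIV] unfolding M_def by fastforce
        then show ?thesis
          unfolding M_def using F(1)[OF n] m_nn by (intro finite_sum_le_infsum) auto
      qed
      then have "2 * \<rho> n * sum (m n) (F n) / (\<epsilon> * M n) \<le> 2 * \<rho> n * M n / (\<epsilon> * M n)"
        using M_pos[OF n] \<epsilon> \<rho>[of n] by (intro divide_right_mono mult_left_mono) auto
      also have "\<dots> = 2 / \<epsilon> / cf_denom \<alpha> n"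
        using M_pos[OF n] by (simp add: \<rho>_def)
      finally have "ennreal (2 * \<rho> n * sum (m n) (F n) / (\<epsilon> * M n)) \<le> ennreal (2 / \<epsilon> / cf_denom \<alpha> n)"
        by (rule ennreal_leI)
      moreover have "emeasure lborel (E n) \<le> ennreal (2 * \<rho> n * sum (m n) (F n) / (\<epsilon> * M n))"
        unfolding E_def using n heavy_points(2)[OF F(1)[OF n] m_nn _ \<rho>] M_pos[OF n] \<epsilon> by auto
      ultimately show ?thesis
        by (rule order_trans[rotated])
    qed
    show "0 \<le> (1 - 2 * \<epsilon>) * M n \<and>
        c * (1 - 2 * \<epsilon>) powr \<beta> \<le> cf_denom \<alpha> n * ((1 - 2 * \<epsilon>) * M n) powr \<beta>" if n: "n \<ge> n1" for n
    proof -
      have "c * (1 - 2 * \<epsilon>) powr \<beta> \<le> cf_denom \<alpha> n * M n powr \<beta> * (1 - 2 * \<epsilon>) powr \<beta>"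
        using c[OF n] unfolding M_def by (intro mult_right_mono) auto
      then show ?thesis
        using M_pos[OF n] \<epsilon> by (simp add: powr_mult mult_ac)
    qed
    fix n u v d
    assume n: "n1 \<le> n" and long: "gauss_prod \<alpha> n < v - u" and short: "v - u \<le> 1 / cf_denom \<alpha> n"
      and "\<not> fold_mod_one u v \<subseteq> E n"
      and d: "\<forall>G. finite G \<and> G \<subseteq> visits \<alpha> u v \<longrightarrow> sum len G \<le> d"
    then obtain y where y: "y \<in> fold_mod_one u v" "y \<notin> E n"
      by blast
    define B where "B = {l \<in> F n. (2 * l + 1) * cf_N \<alpha> n \<in> visits \<alpha> u v}"
    have "sum (m n) (F n - B) \<le> d"
    proof (rule sum_over_windows_le[OF _ _ d, where p = "- cf_N \<alpha> n" and R = "2 * cf_N \<alpha> n"])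
      fix l assume l: "l \<in> F n - B"
      obtain i where i: "i \<in> visits \<alpha> u v" "(2 * l - 1) * cf_N \<alpha> n \<le> i" "i < (2 * l - 1) * cf_N \<alpha> n + cf_Q \<alpha> n"
        using consecutive_visit[OF \<alpha> long, of "(2 * l - 1) * cf_N \<alpha> n"] by blast
      have "i \<noteq> (2 * l + 1) * cf_N \<alpha> n"
        using l i(1) unfolding B_def by auto
      moreover have "i \<le> (2 * l + 1) * cf_N \<alpha> n"
        using i(3) cf_N_bounds[of \<alpha> n] by (simp add: algebra_simps)
      ultimately have "i < (2 * l + 1) * cf_N \<alpha> n"
        by simp
      moreover from this have "m n l \<le> len i"
        unfolding m_def using i by (intro Min_window_le fin) auto
      ultimately show "\<exists>i\<in>visits \<alpha> u v. - cf_N \<alpha> n + l * (2 * cf_N \<alpha> n) \<le> i \<and>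
          i < - cf_N \<alpha> n + (l + 1) * (2 * cf_N \<alpha> n) \<and> m n l \<le> len i"
        using i by (intro bexI[of _ i]) (auto simp: algebra_simps)
    qed (use F(1)[OF n] in auto)
    moreover have "sum (m n) B \<le> \<epsilon> * M n"
    proof -
      have near: "y \<in> fold_mod_one (e n l - \<rho> n) (e n l + \<rho> n)" if l: "l \<in> B" for l
      proof -
        obtain k k' :: int where "u < e n l + of_int k" "e n l + of_int k < v"
          and "0 \<le> y" "y < 1" "u - of_int k' \<le> y" "y \<le> v - of_int k'"
          using l y(1) unfolding B_def visits_def e_def fold_mod_one_def by auto
        then show ?thesis
          using short unfolding fold_mod_one_def \<rho>_def by (intro IntI UN_I[of "k' - k"]) auto
      qed
      have "sum (m n) B = (\<Sum>l\<in>B. m n l * indicator (fold_mod_one (e n l - \<rho> n) (e n l + \<rho> n)) y)"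
        using near by (intro sum.cong) auto
      also have "\<dots> \<le> (\<Sum>l\<in>F n. m n l * indicator (fold_mod_one (e n l - \<rho> n) (e n l + \<rho> n)) y)"
        using F(1)[OF n] m_nn by (intro sum_mono2) (auto simp: B_def)
      also have "\<dots> \<le> \<epsilon> * M n"
        using y n unfolding E_def fold_mod_one_def[of u v] by auto
      finally show ?thesis .
    qed
    moreover have "sum (m n) (F n) = sum (m n) (F n - B) + sum (m n) B"
      using F(1)[OF n] by (intro sum.subset_diff) (auto simp: B_def)
    ultimately show "(1 - 2 * \<epsilon>) * M n \<le> d"
      using F(2)[OF n] by (simp add: algebra_simps)
  qed (use \<beta> \<epsilon> \<open>0 < c\<close> in auto)
qed

lemma overlapping_windows_bound:
  assumes "0 < \<beta>"
  shows "liminf (\<lambda>n. ennreal (real (cf_denom \<alpha> n) *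
      (\<Sum>\<^sub>\<infinity>l::int. Min {len i | i. (2 * l - 1) * cf_N \<alpha> n \<le> i \<and> i \<le> (2 * l + 1) * cf_N \<alpha> n}) powr \<beta>))
    \<le> hausdorff_measure \<beta> \<Omega>"
proof (rule le_of_liminf)
  fix c n1
  assume c: "0 < c" "\<And>n. n \<ge> n1 \<Longrightarrow> c < real (cf_denom \<alpha> n) *
      (\<Sum>\<^sub>\<infinity>l::int. Min {len i | i. (2 * l - 1) * cf_N \<alpha> n \<le> i \<and> i \<le> (2 * l + 1) * cf_N \<alpha> n}) powr \<beta>"
  have "((\<lambda>\<epsilon>. c * (1 - 2 * \<epsilon>) powr \<beta>) \<longlongrightarrow> c * (1 - 2 * 0) powr \<beta>) (at_right 0)"
    by (intro tendsto_intros) auto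
  then have "((\<lambda>\<epsilon>. ennreal (c * (1 - 2 * \<epsilon>) powr \<beta>)) \<longlongrightarrow> ennreal c) (at_right 0)"
    by (intro tendsto_ennrealI) simp
  moreover have "\<forall>\<^sub>F \<epsilon> in at_right 0. ennreal (c * (1 - 2 * \<epsilon>) powr \<beta>) \<le> hausdorff_measure \<beta> \<Omega>"
  proof (rule eventually_at_rightI)
    show "ennreal (c * (1 - 2 * \<epsilon>) powr \<beta>) \<le> hausdorff_measure \<beta> \<Omega>" if "\<epsilon> \<in> {0<..<1 / 2}" for \<epsilon>
      using that by (intro overlapping_windows_bound_up_to_factor[OF assms _ _ c]) auto
  qed simp
  ultimately show "ennreal c \<le> hausdorff_measure \<beta> \<Omega>"
    by (rule tendsto_upperbound) (rule trivial_limit_at_right_real)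
qed

end

theorem theorem10:
  fixes \<delta> \<alpha> \<beta> :: real
    and len :: "int \<Rightarrow> real"
    and J :: "int \<Rightarrow> circle set"
    and f :: "circle \<Rightarrow> circle"
  assumes "0 < \<delta>" and "\<delta> < 1"
    and "0 < \<alpha>" and "\<alpha> < 1" and "\<alpha> \<notin> \<rat>"
    and "denjoy_sequence \<delta> len"
    and "denjoy_map \<delta> \<alpha> len J f"
    and "0 < \<beta>"
  shows "hausdorff_measure \<beta> (denjoy_minimal_set J) \<ge>
           liminf (\<lambda>n. ennreal (real (cf_denom \<alpha> n) *
             (Min {len i | i. - cf_N \<alpha> n \<le> i \<and> i \<le> cf_N \<alpha> n}) powr \<beta>))
       \<and> hausdorff_measure \<beta> (denjoy_minimal_set J) \<ge>
           liminf (\<lambda>n. ennreal (real (cf_denom \<alpha> n) *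
             (\<Sum>\<^sub>\<infinity>l::int. Min {len i | i. (2 * l - 1) * cf_N \<alpha> n \<le> i \<and> i \<le> (2 * l + 1) * cf_N \<alpha> n}) powr \<beta>))
       \<and> hausdorff_measure \<beta> (denjoy_minimal_set J) \<ge>
           liminf (\<lambda>n. ennreal (real (cf_denom \<alpha> n) *
             (SUP P \<in> {P :: int \<Rightarrow> int. \<forall>l. P l - P (l - 1) = cf_Q \<alpha> n}.
                \<Sum>\<^sub>\<infinity>l::int. Min {len i | i. P (l - 1) \<le> i \<and> i < P l}) powr \<beta>))"
proof -
  have "\<And>n. 0 < len n"
    using assms(6) unfolding denjoy_sequence_def by blast
  then obtain b H where "collapsed_gaps \<alpha> len b H (denjoy_minimal_set J)"
    using denjoy_map_collapsed_gaps[OF assms(3-5) _ assms(7)] by metis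
  then interpret collapsed_gaps \<alpha> len b H "denjoy_minimal_set J" .
  show ?thesis
    using central_window_bound[OF assms(8)] overlapping_windows_bound[OF assms(8)]
      disjoint_windows_bound[OF assms(8)] by blast
qed

end
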